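(* Let $(W,S)$ be a Coxeter system with $S$ finite and let $c\in W$ be a Coxeter element. Let $x\in[1,c]_T$. Then $\dim(\mathsf{AM}(x))=\ell_T(x)$. Moreover, for every $T$-reduced expression $t_1t_2\cdots t_k$ of $x$, we have $$\mathsf{AM}(x)=\mathbb{R}\alpha_{t_1}\oplus\mathbb{R}\alpha_{t_2}\oplus\cdots\oplus\mathbb{R}\alpha_{t_k}.$$
   Context: $T=\bigcup_{w\in W} wSw^{-1}$ is the set of reflections of $W$. The reflection length $\ell_T(w)$ is the smallest $k\ge 0$ such that $w$ is a product of $k$ elements of $T$. A $T$-reduced expression of $w$ is a word $t_1t_2\cdots t_k$ in elements of $T$ with $w=t_1t_2\cdots t_k$ and $k=\ell_T(w)$. The absolute order is the partial order on $W$ defined by $u\leq_T v \iff \ell_T(u)+\ell_T(u^{-1}v)=\ell_T(v)$. A Coxeter element is a product of all the elements of $S$, each occurring exactly once, in some order. $[1,c]_T=\{x\in W\mid x\leq_T c\}$. $V$ is the geometric representation of $W$: the real vector space with basis $\{\alpha_s\}_{s\in S}$, with symmetric bilinear form $B$ given by $B(\alpha_s,\alpha_{s'})=-\cos(\pi/m_{ss'})$ (equal to $-1$ if $m_{ss'}=\infty$), on which $s\in S$ acts by $s(v)=v-2B(\alpha_s,v)\alpha_s$. The root system is $\Phi=\{w(\alpha_s)\mid w\in W, s\in S\}=\Phi^+\sqcup\Phi^-$; for $t\in T$, $\alpha_t\in\Phi^+$ denotes the unique positive root such that $t(v)=v-2B(\alpha_t,v)\alpha_t$ for all $v \in V$.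 For $x\in[1,c]_T$, the absolute moved space of $x$ is $\mathsf{AM}(x)=\sum_{t\in T,\ t\leq_T x}\mathbb{R}\alpha_t\subseteq V$. *)

theory Defs
  imports
    "HOL-Algebra.Generated_Groups"
    "HOL-Library.Extended_Nat"
    "HOL-Library.FuncSet"
    "HOL-Analysis.Finite_Function_Topology"
begin

section \<open>Coxeter systems\<close>

definition word_prod :: "('a, 'b) monoid_scheme \<Rightarrow> 'a list \<Rightarrow> 'a" where
  "word_prod G ws = foldr (\<otimes>\<^bsub>G\<^esub>) ws \<one>\<^bsub>G\<^esub>"

definition coxeter_matrix :: "'a set \<Rightarrow> ('a \<Rightarrow> 'a \<Rightarrow> enat) \<Rightarrow> bool" where
  "coxeter_matrix S m \<longleftrightarrow>
     (\<forall>s\<in>S. m s s = 1) \<and>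
     (\<forall>s\<in>S. \<forall>t\<in>S. m s t = m t s) \<and>
     (\<forall>s\<in>S. \<forall>t\<in>S. s \<noteq> t \<longrightarrow> 2 \<le> m s t)"

text \<open>
  The congruence on words in \<open>S\<close> generated by \<open>(s t)^m(s,t) = 1\<close> for \<open>m(s,t)\<close> finite.
  Because \<open>m(s,s) = 1\<close>, the relations contain \<open>s s = 1\<close>, so formal inverses of the generators
  are not needed and the quotient of the words by this congruence is the group with
  generators \<open>S\<close> and these relations.
\<close>

inductive coxeter_cong :: "'a set \<Rightarrow> ('a \<Rightarrow> 'a \<Rightarrow> enat) \<Rightarrow> 'a list \<Rightarrow> 'a list \<Rightarrow> bool"
  for S :: "'a set" and m :: "'a \<Rightarrow> 'a \<Rightarrow> enat" where
  cc_rel: "s \<in> S \<Longrightarrow> t \<in> S \<Longrightarrow> m s t = enat k \<Longrightarrow> coxeter_cong S m (concat (replicate k [s, t])) []"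
| cc_refl: "coxeter_cong S m u u"
| cc_sym: "coxeter_cong S m u v \<Longrightarrow> coxeter_cong S m v u"
| cc_trans: "coxeter_cong S m u v \<Longrightarrow> coxeter_cong S m v w \<Longrightarrow> coxeter_cong S m u w"
| cc_ctxt: "coxeter_cong S m u v \<Longrightarrow> a \<in> lists S \<Longrightarrow> b \<in> lists S \<Longrightarrow>
            coxeter_cong S m (a @ u @ b) (a @ v @ b)"

definition coxeter_system :: "('a, 'b) monoid_scheme \<Rightarrow> 'a set \<Rightarrow> ('a \<Rightarrow> 'a \<Rightarrow> enat) \<Rightarrow> bool" where
  "coxeter_system G S m \<longleftrightarrow>
     group G \<and> S \<subseteq> carrier G \<and> coxeter_matrix S m \<and>
     generate G S = carrier G \<and>
     (\<forall>u\<in>lists S. \<forall>v\<in>lists S. word_prod G u = word_prod G v \<longleftrightarrow> coxeter_cong S m u v)"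

definition coxeter_element :: "('a, 'b) monoid_scheme \<Rightarrow> 'a set \<Rightarrow> 'a \<Rightarrow> bool" where
  "coxeter_element G S c \<longleftrightarrow> (\<exists>ws. distinct ws \<and> set ws = S \<and> c = word_prod G ws)"

section \<open>Reflections and the absolute order\<close>

definition reflections :: "('a, 'b) monoid_scheme \<Rightarrow> 'a set \<Rightarrow> 'a set" where
  "reflections G S = (\<Union>w\<in>carrier G. (w <#\<^bsub>G\<^esub> S) #>\<^bsub>G\<^esub> inv\<^bsub>G\<^esub> w)"

definition refl_length :: "('a, 'b) monoid_scheme \<Rightarrow> 'a set \<Rightarrow> 'a \<Rightarrow> nat" where
  "refl_length G S w =
     (LEAST k. \<exists>ts \<in> lists (reflections G S). length ts = k \<and> word_prod G ts = w)"

definition T_reduced_expression :: "('a, 'b) monoid_scheme \<Rightarrow> 'a set \<Rightarrow> 'a \<Rightarrow> 'a list \<Rightarrow> bool" where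
  "T_reduced_expression G S w ts \<longleftrightarrow>
     ts \<in> lists (reflections G S) \<and> word_prod G ts = w \<and> length ts = refl_length G S w"

definition absolute_le :: "('a, 'b) monoid_scheme \<Rightarrow> 'a set \<Rightarrow> 'a \<Rightarrow> 'a \<Rightarrow> bool" where
  "absolute_le G S u v \<longleftrightarrow>
     refl_length G S u + refl_length G S (inv\<^bsub>G\<^esub> u \<otimes>\<^bsub>G\<^esub> v) = refl_length G S v"

definition absolute_interval :: "('a, 'b) monoid_scheme \<Rightarrow> 'a set \<Rightarrow> 'a \<Rightarrow> 'a set" where
  "absolute_interval G S c = {x \<in> carrier G. absolute_le G S x c}"

section \<open>The geometric representation and its roots\<close>

text \<open>
  The real vector space with basis \<open>S\<close> is the space of finitely supported functions with
  support in \<open>S\<close>; the basis vector of \<open>s\<close> is \<open>Poly_Mapping.single s 1\<close>.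
\<close>

definition geom_space :: "'a set \<Rightarrow> ('a \<Rightarrow>\<^sub>0 real) set" where
  "geom_space S = {v. Poly_Mapping.keys v \<subseteq> S}"

definition simple_root :: "'a \<Rightarrow> ('a \<Rightarrow>\<^sub>0 real)" where
  "simple_root s = Poly_Mapping.single s 1"

definition simple_form :: "('a \<Rightarrow> 'a \<Rightarrow> enat) \<Rightarrow> 'a \<Rightarrow> 'a \<Rightarrow> real" where
  "simple_form m s t = (case m s t of enat k \<Rightarrow> - cos (pi / real k) | \<infinity> \<Rightarrow> - 1)"

definition geom_form :: "('a \<Rightarrow> 'a \<Rightarrow> enat) \<Rightarrow> ('a \<Rightarrow>\<^sub>0 real) \<Rightarrow> ('a \<Rightarrow>\<^sub>0 real) \<Rightarrow> real" where
  "geom_form m u v =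
     (\<Sum>s\<in>Poly_Mapping.keys u. \<Sum>t\<in>Poly_Mapping.keys v.
        Poly_Mapping.lookup u s * Poly_Mapping.lookup v t * simple_form m s t)"

definition geom_reflection ::
  "('a \<Rightarrow> 'a \<Rightarrow> enat) \<Rightarrow> ('a \<Rightarrow>\<^sub>0 real) \<Rightarrow> ('a \<Rightarrow>\<^sub>0 real) \<Rightarrow> ('a \<Rightarrow>\<^sub>0 real)" where
  "geom_reflection m \<beta> v = v - (2 * geom_form m \<beta> v) *\<^sub>R \<beta>"

text \<open>
  A group element acts through a word in \<open>S\<close> representing it. As the simple reflections satisfy
  the defining relations of the group, the choice of the word does not matter, and this is the
  action of the group extending that of \<open>S\<close>.
\<close>

definition geom_action ::
  "('a, 'b) monoid_scheme \<Rightarrow> 'a set \<Rightarrow> ('a \<Rightarrow> 'a \<Rightarrow> enat) \<Rightarrow> 'a \<Rightarrow> ('a \<Rightarrow>\<^sub>0 real) \<Rightarrow> ('a \<Rightarrow>\<^sub>0 real)" where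
  "geom_action G S m w =
     foldr (\<lambda>s. geom_reflection m (simple_root s)) (SOME ws. ws \<in> lists S \<and> word_prod G ws = w)"

definition root_system ::
  "('a, 'b) monoid_scheme \<Rightarrow> 'a set \<Rightarrow> ('a \<Rightarrow> 'a \<Rightarrow> enat) \<Rightarrow> ('a \<Rightarrow>\<^sub>0 real) set" where
  "root_system G S m = {geom_action G S m w (simple_root s) |w s. w \<in> carrier G \<and> s \<in> S}"

definition positive_roots ::
  "('a, 'b) monoid_scheme \<Rightarrow> 'a set \<Rightarrow> ('a \<Rightarrow> 'a \<Rightarrow> enat) \<Rightarrow> ('a \<Rightarrow>\<^sub>0 real) set" where
  "positive_roots G S m = {\<beta> \<in> root_system G S m. \<forall>s. 0 \<le> Poly_Mapping.lookup \<beta> s}"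

definition root_of ::
  "('a, 'b) monoid_scheme \<Rightarrow> 'a set \<Rightarrow> ('a \<Rightarrow> 'a \<Rightarrow> enat) \<Rightarrow> 'a \<Rightarrow> ('a \<Rightarrow>\<^sub>0 real)" where
  "root_of G S m t =
     (THE \<beta>. \<beta> \<in> positive_roots G S m \<and>
             (\<forall>v\<in>geom_space S. geom_action G S m t v = geom_reflection m \<beta> v))"

section \<open>Absolute moved spaces\<close>

definition abs_moved_space ::
  "('a, 'b) monoid_scheme \<Rightarrow> 'a set \<Rightarrow> ('a \<Rightarrow> 'a \<Rightarrow> enat) \<Rightarrow> 'a \<Rightarrow> ('a \<Rightarrow>\<^sub>0 real) set" where
  "abs_moved_space G S m x =
     span {root_of G S m t |t. t \<in> reflections G S \<and> absolute_le G S t x}"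

text \<open>
  \<open>U\<close> is the internal direct sum of the subspaces listed in \<open>Us\<close>: every element of \<open>U\<close> is
  in a unique way a sum of one element from each entry, and all such sums lie in \<open>U\<close>.
  Repeated entries count separately.
\<close>

definition internal_direct_sum :: "'v::real_vector set \<Rightarrow> 'v set list \<Rightarrow> bool" where
  "internal_direct_sum U Us \<longleftrightarrow>
     (\<forall>X\<in>set Us. subspace X) \<and>
     bij_betw (\<lambda>f. \<Sum>i<length Us. f i) (\<Pi>\<^sub>E i\<in>{..<length Us}. Us ! i) U"

end

theory Submission
  imports Defs
begin

text \<open>
  The absolute moved space of \<open>x\<close> turns out to be an ordinary moved space, the range of
  \<open>x - 1\<close>, not on the geometric representation \<open>V\<close> itself but on a larger
  representation. On \<open>V\<close> the form may be degenerate, and then the range of \<open>x - 1\<close> can be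
  too small. The remedy is to let the group act on \<open>V \<times> V\<^sup>*\<close> by the
  reflections in the simple roots for the form that adds the pairing of \<open>V\<close> with its dual. Roots
  still lie in \<open>V\<close>, but independent vectors of \<open>V\<close> now define independent functionals
  (\<open>separates_geom_space\<close>).

  On this space the moved space of a product of reflections lies in the span of their roots, with equality
  if the roots are independent (\<open>moved_space_subset_span\<close>,
  \<open>moved_space_independent\<close>). Applied to the defining word of a Coxeter element \<open>c\<close>,
  this says that \<open>c\<close> moves all of \<open>V\<close>. So every factorization of \<open>c\<close> into at most
  \<open>card S\<close> reflections has distinct and linearly independent roots
  (\<open>coxeter_element_factorization_independent\<close>). For \<open>x \<le>\<^sub>T c\<close>, a reduced
  expression of \<open>x\<close> extends to such a factorization, so its roots are independent and their span is
  the moved space of \<open>x\<close>. As the latter does not depend on the expression, and the reflections below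
  \<open>x\<close> are the letters of its reduced expressions, this common span is the absolute moved space
  (\<open>abs_moved_space_eq_span\<close>).

  What remains is the classical theory that gives \<open>root_of\<close> its meaning: the simple reflections
  satisfy the Coxeter relations (\<open>reflect_dihedral_relation\<close>), and every root is a nonnegative or
  a nonpositive combination of simple roots (\<open>act_simple_sign\<close>). Both are proved for an arbitrary
  space with a form that has the prescribed values on the simple roots, and so hold for the enlarged
  space too.
\<close>

section \<open>Reflections of a symmetric bilinear form and moved spaces\<close>

locale symmetric_form =
  fixes b :: "'v::real_vector \<Rightarrow> 'v \<Rightarrow> real"
  assumes form_add: "b (x + y) z = b x z + b y z"
    and form_scale: "b (a *\<^sub>R x) z = a * b x z"
    and form_sym: "b x y = b y x"
begin

lemma form_add_right: "b z (x + y) = b z x + b z y"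
  using form_add form_sym by metis

lemma form_scale_right: "b z (a *\<^sub>R x) = a * b z x"
  using form_scale form_sym by metis

lemma form_diff: "b (x - y) z = b x z - b y z"
  using form_add[of x "(-1) *\<^sub>R y" z] form_scale[of "-1" y z] by simp

lemma form_diff_right: "b z (x - y) = b z x - b z y"
  using form_diff form_sym by metis

lemma form_uminus: "b (- x) z = - b x z"
  using form_scale[of "-1" x z] by simp

lemma form_uminus_right: "b z (- x) = - b z x"
  using form_uminus form_sym by metis

lemmas form_simps = form_add form_add_right form_scale form_scale_right form_diff form_diff_right
  form_uminus form_uminus_right

definition reflect :: "'v \<Rightarrow> 'v \<Rightarrow> 'v" where
  "reflect \<beta> v = v - (2 * b \<beta> v) *\<^sub>R \<beta>"

definition reflect_word :: "'v list \<Rightarrow> 'v \<Rightarrow> 'v" where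
  "reflect_word \<beta>s = foldr reflect \<beta>s"

lemma reflect_word_simps [simp]:
  "reflect_word [] v = v"
  "reflect_word (\<beta> # \<beta>s) v = reflect \<beta> (reflect_word \<beta>s v)"
  by (simp_all add: reflect_word_def)

lemma reflect_word_append: "reflect_word (\<beta>s @ \<gamma>s) v = reflect_word \<beta>s (reflect_word \<gamma>s v)"
  by (simp add: reflect_word_def)

lemma linear_reflect: "linear (reflect \<beta>)"
  by (rule linearI) (simp_all add: reflect_def form_simps algebra_simps)

lemma linear_reflect_word: "linear (reflect_word \<beta>s)"
proof (induction \<beta>s)
  case Nil
  have "reflect_word [] = id" by (auto simp: fun_eq_iff)
  then show ?case using linear_id by (simp add: id_def)
next
  case (Cons \<beta> \<beta>s)
  have "reflect_word (\<beta> # \<beta>s) = reflect \<beta> \<circ> reflect_word \<beta>s" by (auto simp: fun_eq_iff)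
  then show ?case using linear_compose[OF Cons linear_reflect[of \<beta>]] by metis
qed

lemma reflect_self: "b \<beta> \<beta> = 1 \<Longrightarrow> reflect \<beta> \<beta> = - \<beta>"
  by (simp add: reflect_def scaleR_2)

lemma reflect_involution: "b \<beta> \<beta> = 1 \<Longrightarrow> reflect \<beta> (reflect \<beta> v) = v"
  by (simp add: reflect_def form_simps algebra_simps)

lemma reflect_uminus: "reflect (- \<beta>) = reflect \<beta>"
  by (simp add: reflect_def fun_eq_iff form_simps)

lemma reflect_isometry: "b \<beta> \<beta> = 1 \<Longrightarrow> b (reflect \<beta> u) (reflect \<beta> v) = b u v"
  using form_sym[of \<beta> u] by (simp add: reflect_def form_simps algebra_simps)

lemma reflect_word_isometry:
  "\<forall>\<beta>\<in>set \<beta>s. b \<beta> \<beta> = 1 \<Longrightarrow> b (reflect_word \<beta>s u) (reflect_word \<beta>s v) = b u v"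
  by (induction \<beta>s) (auto simp: reflect_isometry)

lemma reflect_word_rev:
  "\<forall>\<beta>\<in>set \<beta>s. b \<beta> \<beta> = 1 \<Longrightarrow> reflect_word \<beta>s (reflect_word (rev \<beta>s) v) = v"
  by (induction \<beta>s arbitrary: v) (auto simp: reflect_involution reflect_word_append)

text \<open>
  A product of reflections is an isometry, and an isometry \<open>g\<close> carries the hyperplane orthogonal to
  \<open>\<beta>\<close> to the one orthogonal to \<open>g \<beta>\<close>. The reversed word provides the inverse of \<open>g\<close>.
\<close>

lemma reflect_conjugate:
  assumes "\<forall>\<gamma>\<in>set \<gamma>s. b \<gamma> \<gamma> = 1"
  shows "reflect_word \<gamma>s (reflect \<beta> (reflect_word (rev \<gamma>s) v)) = reflect (reflect_word \<gamma>s \<beta>) v"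
proof -
  have "b \<beta> (reflect_word (rev \<gamma>s) v) = b (reflect_word \<gamma>s \<beta>) v"
    using reflect_word_isometry[OF assms, of \<beta> "reflect_word (rev \<gamma>s) v"]
    by (simp add: reflect_word_rev[OF assms])
  then show ?thesis
    using linear_reflect_word[of \<gamma>s]
    by (simp add: reflect_def linear_diff linear_scale reflect_word_rev[OF assms])
qed

definition moved_space :: "('v \<Rightarrow> 'v) \<Rightarrow> 'v set" where
  "moved_space g = range (\<lambda>v. g v - v)"

lemma moved_spaceI: "g v - v \<in> moved_space g"
  by (simp add: moved_space_def)

lemma subspace_moved_space: "linear g \<Longrightarrow> subspace (moved_space g)"
  unfolding moved_space_def
  by (rule linear_subspace_image[OF _ subspace_UNIV]) (intro linear_compose_sub linear_ident)

lemma moved_space_subset_span: "moved_space (reflect_word \<beta>s) \<subseteq> span (set \<beta>s)"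
proof -
  have "reflect_word \<beta>s v - v \<in> span (set \<beta>s)" for v
  proof (induction \<beta>s)
    case Nil
    then show ?case by simp
  next
    case (Cons \<beta> \<beta>s)
    have "reflect_word \<beta>s v - v \<in> span (set (\<beta> # \<beta>s))"
      using Cons span_mono[of "set \<beta>s" "set (\<beta> # \<beta>s)"] by auto
    moreover have "(2 * b \<beta> (reflect_word \<beta>s v)) *\<^sub>R \<beta> \<in> span (set (\<beta> # \<beta>s))"
      by (intro span_scale span_base) simp
    ultimately show ?case
      using span_diff by (fastforce simp: reflect_def algebra_simps)
  qed
  then show ?thesis by (auto simp: moved_space_def)
qed

text \<open>
  This is the nondegeneracy that the counting of dimensions needs: linearly independent vectors of
  \<open>U\<close> give linearly independent functionals \<open>b \<beta>\<close>. It fails for the geometric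
  representation whenever its form has a radical, which is the reason for enlarging that representation.
\<close>

definition separates :: "'v set \<Rightarrow> bool" where
  "separates U \<longleftrightarrow> (\<forall>\<beta> X. insert \<beta> X \<subseteq> U \<longrightarrow> \<beta> \<notin> X \<longrightarrow> independent (insert \<beta> X) \<longrightarrow>
      (\<exists>z. b \<beta> z = 1 \<and> (\<forall>\<gamma>\<in>X. b \<gamma> z = 0)))"

text \<open>
  The moved space of a product of reflections in independent vectors does not depend on the product, only
  on its value as a linear map, yet it recovers the span of these vectors. For the first vector
  \<open>\<beta>\<close>, take \<open>z\<close> orthogonal to all the others: the other reflections fix \<open>z\<close>, so
  \<open>z\<close> is moved along \<open>\<beta>\<close>. The remaining vectors lie in the moved space of the shorter
  product, which differs from that of the full product by multiples of \<open>\<beta>\<close>.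
\<close>

lemma moved_space_independent:
  assumes "separates U" "set \<beta>s \<subseteq> U" "distinct \<beta>s" "independent (set \<beta>s)"
  shows "moved_space (reflect_word \<beta>s) = span (set \<beta>s)"
proof (rule antisym[OF moved_space_subset_span])
  show "span (set \<beta>s) \<subseteq> moved_space (reflect_word \<beta>s)"
    using assms(2-4)
  proof (induction \<beta>s)
    case Nil
    then show ?case by (auto simp: moved_space_def)
  next
    case (Cons \<beta> \<beta>s)
    let ?M = "moved_space (reflect_word (\<beta> # \<beta>s))"
    have sub: "subspace ?M"
      by (intro subspace_moved_space linear_reflect_word)
    have IH: "span (set \<beta>s) \<subseteq> moved_space (reflect_word \<beta>s)"
      using Cons.IH Cons.prems independent_mono[of "set (\<beta> # \<beta>s)" "set \<beta>s"] by auto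
    obtain z where z: "b \<beta> z = 1" "\<forall>\<gamma>\<in>set \<beta>s. b \<gamma> z = 0"
      using assms(1) Cons.prems unfolding separates_def
      by (metis distinct.simps(2) list.simps(15))
    have "reflect_word \<gamma>s z = z" if "\<forall>\<gamma>\<in>set \<gamma>s. b \<gamma> z = 0" for \<gamma>s
      using that by (induction \<gamma>s) (auto simp: reflect_def)
    then have "reflect_word (\<beta> # \<beta>s) z - z = (- 2) *\<^sub>R \<beta>"
      using z by (simp add: reflect_def)
    then have "(- 2) *\<^sub>R \<beta> \<in> ?M"
      using moved_spaceI[of "reflect_word (\<beta> # \<beta>s)" z] by simp
    then have "(- 1 / 2) *\<^sub>R ((- 2) *\<^sub>R \<beta>) \<in> ?M"
      by (rule subspace_scale[OF sub])
    then have \<beta>: "\<beta> \<in> ?M" by simp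
    have "\<gamma> \<in> ?M" if \<gamma>: "\<gamma> \<in> set \<beta>s" for \<gamma>
    proof -
      obtain u where u: "\<gamma> = reflect_word \<beta>s u - u"
        using IH span_base[OF \<gamma>] by (auto simp: moved_space_def)
      have "\<gamma> = (reflect_word (\<beta> # \<beta>s) u - u) + (2 * b \<beta> (reflect_word \<beta>s u)) *\<^sub>R \<beta>"
        by (simp add: u reflect_def)
      then show ?thesis
        using subspace_add[OF sub moved_spaceI subspace_scale[OF sub \<beta>]] by metis
    qed
    then have "set (\<beta> # \<beta>s) \<subseteq> ?M" using \<beta> by auto
    then show ?case by (rule span_minimal[OF _ sub])
  qed
qed

end

section \<open>Two reflections\<close>

text \<open>
  These are the Chebyshev polynomials of the second kind, shifted by one: \<open>sin (k \<theta>) / sin \<theta>\<close>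
  at \<open>c = cos \<theta>\<close>. The recursion also covers \<open>c = 1\<close>, where the quotient of sines is
  replaced by its limit \<open>k\<close> and which is the case \<open>m s t = \<infinity>\<close>.
\<close>

fun dihedral_coeff :: "real \<Rightarrow> nat \<Rightarrow> real" where
  "dihedral_coeff c 0 = 0"
| "dihedral_coeff c (Suc 0) = 1"
| "dihedral_coeff c (Suc (Suc k)) = 2 * c * dihedral_coeff c (Suc k) - dihedral_coeff c k"

lemma dihedral_coeff_cos: "dihedral_coeff (cos \<theta>) k * sin \<theta> = sin (real k * \<theta>)"
proof (induction "cos \<theta>" k rule: dihedral_coeff.induct)
  case (3 k)
  have "sin (real (Suc (Suc k)) * \<theta>) + sin (real k * \<theta>) = 2 * cos \<theta> * sin (real (Suc k) * \<theta>)"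
  proof -
    have "sin (real (Suc k) * \<theta> + \<theta>) + sin (real (Suc k) * \<theta> - \<theta>) = 2 * cos \<theta> * sin (real (Suc k) * \<theta>)"
      by (simp add: sin_add sin_diff)
    then show ?thesis by (simp add: algebra_simps)
  qed
  then show ?case using 3 by (simp add: algebra_simps)
qed auto

lemma dihedral_coeff_one: "dihedral_coeff 1 k = real k"
  by (induction "1::real" k rule: dihedral_coeff.induct) auto

text \<open>
  For \<open>\<theta> = pi / n\<close> the angles \<open>k \<theta>\<close> with \<open>k \<le> n\<close> stay in the interval where the
  sine is nonnegative. This is where the precise value of the form on simple roots enters.
\<close>

lemma dihedral_coeff_nonneg:
  assumes "2 \<le> n" "k \<le> n"
  shows "0 \<le> dihedral_coeff (cos (pi / real n)) k"
proof -
  have "real k * (pi / real n) \<le> pi"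
    using assms by (simp add: field_simps)
  then have "0 \<le> sin (real k * (pi / real n))"
    by (intro sin_ge_zero) auto
  moreover have "0 < sin (pi / real n)"
    using assms by (intro sin_gt_zero) (auto simp: field_simps)
  ultimately show ?thesis
    by (metis dihedral_coeff_cos mult_neg_pos not_le)
qed

fun alternating :: "nat \<Rightarrow> 'a \<Rightarrow> 'a \<Rightarrow> 'a list" where
  "alternating 0 x y = []"
| "alternating (Suc k) x y = x # alternating k y x"

lemma length_alternating [simp]: "length (alternating k x y) = k"
  by (induction k arbitrary: x y) auto

lemma alternating_double: "alternating (2 * k) x y = concat (replicate k [x, y])"
  by (induction k) auto

lemma alternating_snoc: "alternating (Suc k) x y = alternating k x y @ [if even k then x else y]"
proof (induction k arbitrary: x y)
  case (Suc k)
  have "alternating (Suc (Suc k)) x y = x # alternating (Suc k) y x" by simp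
  also have "\<dots> = x # alternating k y x @ [if even k then y else x]" by (subst Suc) simp
  finally show ?case by auto
qed auto

lemma alternating_append: "\<exists>w. alternating (j + k) x y = alternating j x y @ w"
  by (induction j arbitrary: x y) auto

lemma map_alternating: "map f (alternating k x y) = alternating k (f x) (f y)"
  by (induction k arbitrary: x y) auto

lemma rev_concat_replicate_pair: "rev (concat (replicate k [x, y])) = concat (replicate k [y, x])"
proof (induction k)
  case (Suc k)
  have "concat (replicate k [y, x]) @ [y, x] = concat (replicate (Suc k) [y, x])"
    by (induction k) auto
  then show ?case using Suc by simp
qed auto

context symmetric_form
begin

text \<open>
  The vector is chosen so that the letter acting first is the other one; each further letter then
  replaces the older of the two coefficients according to the recursion of \<open>dihedral_coeff\<close>.
\<close>

lemma reflect_alternating: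
  assumes "b x x = 1" "b y y = 1" "b x y = - c"
  shows "reflect_word (alternating k x y) (if even k then x else y) =
    dihedral_coeff c (Suc k) *\<^sub>R x + dihedral_coeff c k *\<^sub>R y"
  using assms
proof (induction k arbitrary: x y)
  case 0
  then show ?case by simp
next
  case (Suc k)
  have "reflect_word (alternating k y x) (if even k then y else x) =
    dihedral_coeff c (Suc k) *\<^sub>R y + dihedral_coeff c k *\<^sub>R x"
    using Suc.IH[of y x] Suc.prems form_sym[of x y] by simp
  then have "reflect_word (alternating (Suc k) x y) (if even (Suc k) then x else y) =
     reflect x (dihedral_coeff c (Suc k) *\<^sub>R y + dihedral_coeff c k *\<^sub>R x)"
    by (cases "even k") simp_all
  also have "\<dots> = dihedral_coeff c (Suc (Suc k)) *\<^sub>R x + dihedral_coeff c (Suc k) *\<^sub>R y"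
    using Suc.prems by (simp add: reflect_def form_simps algebra_simps flip: scaleR_2)
  finally show ?case .
qed

text \<open>
  The plane spanned by \<open>x\<close> and \<open>y\<close> has Gram determinant \<open>1 - cos\<^sup>2 \<theta> > 0\<close>, so
  every vector is the sum of a vector of this plane and one orthogonal to it. The latter is fixed by both
  reflections, and on the plane the relation can be read off from the dihedral coefficients. The argument
  uses the form on this plane only, so it applies to every space into which the plane is embedded.
\<close>

lemma reflect_dihedral_relation:
  assumes "b x x = 1" "b y y = 1" "b x y = - cos (pi / real n)" "2 \<le> n"
  shows "reflect_word (concat (replicate n [x, y])) v = v"
proof -
  define \<theta> where "\<theta> = pi / real n"
  have sin: "sin \<theta> > 0"
    using assms unfolding \<theta>_def by (intro sin_gt_zero) (auto simp: field_simps)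
  have n\<theta>: "real (2 * n) * \<theta> = 2 * pi" "real (Suc (2 * n)) * \<theta> = 2 * pi + \<theta>"
    using assms by (auto simp: \<theta>_def field_simps)
  have U: "dihedral_coeff (cos \<theta>) (Suc (2 * n)) = 1" "dihedral_coeff (cos \<theta>) (2 * n) = 0"
    using dihedral_coeff_cos[of \<theta> "Suc (2 * n)"] dihedral_coeff_cos[of \<theta> "2 * n"] sin
    unfolding n\<theta> by (simp_all add: sin_add)
  let ?D = "reflect_word (concat (replicate n [x, y]))"
  have fix1: "reflect_word (concat (replicate n [p, q])) p = p"
    if "b p p = 1" "b q q = 1" "b p q = - cos \<theta>" for p q
    using reflect_alternating[OF that, of "2 * n"] U by (simp add: alternating_double)
  have Dx: "?D x = x"
    using fix1 assms by (simp add: \<theta>_def)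
  \<comment> \<open>The product in the opposite order is the inverse of \<open>?D\<close> and fixes \<open>y\<close> by symmetry.\<close>
  have "?D (reflect_word (rev (concat (replicate n [x, y]))) y) = y"
    using assms by (intro reflect_word_rev) auto
  then have Dy: "?D y = y"
    using fix1[of y x] assms form_sym[of x y] by (simp add: \<theta>_def rev_concat_replicate_pair)
  define p q where "p = b x v" and "q = b y v"
  \<comment> \<open>Cramer's rule for the component of \<open>v\<close> in the plane.\<close>
  define a d where "a = (p + q * cos \<theta>) / (sin \<theta>)\<^sup>2" and "d = (q + p * cos \<theta>) / (sin \<theta>)\<^sup>2"
  have s2: "(sin \<theta>)\<^sup>2 = 1 - (cos \<theta>)\<^sup>2" by (simp add: sin_squared_eq)
  have "a - d * cos \<theta> = (p * (1 - (cos \<theta>)\<^sup>2)) / (sin \<theta>)\<^sup>2"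
    unfolding a_def d_def by (simp add: diff_divide_distrib[symmetric] power2_eq_square algebra_simps)
  then have ax: "a - d * cos \<theta> = p" using sin s2 by (metis nonzero_mult_div_cancel_right less_irrefl zero_less_power)
  have "d - a * cos \<theta> = (q * (1 - (cos \<theta>)\<^sup>2)) / (sin \<theta>)\<^sup>2"
    unfolding a_def d_def by (simp add: diff_divide_distrib[symmetric] power2_eq_square algebra_simps)
  then have dy: "d - a * cos \<theta> = q" using sin s2 by (metis nonzero_mult_div_cancel_right less_irrefl zero_less_power)
  define z where "z = v - (a *\<^sub>R x + d *\<^sub>R y)"
  have "b x z = 0" "b y z = 0"
    using ax dy assms form_sym[of x y]
    by (simp_all add: z_def form_simps \<theta>_def[symmetric] p_def q_def algebra_simps)
  then have "?D z = z"
    by (induction n) (simp_all add: reflect_def)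
  moreover have "v = z + (a *\<^sub>R x + d *\<^sub>R y)" by (simp add: z_def)
  ultimately show ?thesis
    using linear_reflect_word[of "concat (replicate n [x, y])"] Dx Dy
    by (simp add: linear_add linear_scale)
qed

end

section \<open>Words modulo the Coxeter relations\<close>

lemma coxeter_cong_parity: "coxeter_cong S m u v \<Longrightarrow> even (length u) = even (length v)"
proof (induction rule: coxeter_cong.induct)
  case (cc_rel s t k)
  have "even (length (concat (replicate k [s, t])))" by (induction k) auto
  then show ?case by simp
qed auto

lemma coxeter_cong_lists: "coxeter_cong S m u v \<Longrightarrow> u \<in> lists S \<longleftrightarrow> v \<in> lists S"
proof (induction rule: coxeter_cong.induct)
  case (cc_rel s t k)
  then have "concat (replicate j [s, t]) \<in> lists S" for j by (induction j) auto
  then show ?case by simp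
qed auto

lemma coxeter_cong_append:
  assumes "coxeter_cong S m u u'" "coxeter_cong S m v v'" "u' \<in> lists S" "v \<in> lists S"
  shows "coxeter_cong S m (u @ v) (u' @ v')"
  using cc_trans[of S m "[] @ u @ v" "[] @ u' @ v" "u' @ v' @ []"]
    cc_ctxt[OF assms(1), of "[]" v] cc_ctxt[OF assms(2), of u' "[]"] assms(3,4)
  by simp

lemma coxeter_cong_square:
  assumes "coxeter_matrix S m" "s \<in> S"
  shows "coxeter_cong S m [s, s] []"
  using cc_rel[of s S s m 1] assms by (simp add: coxeter_matrix_def one_enat_def)

lemma coxeter_cong_rev:
  assumes "coxeter_matrix S m" "w \<in> lists S"
  shows "coxeter_cong S m (w @ rev w) []"
  using assms(2)
proof (induction w)
  case (Cons s w)
  have "coxeter_cong S m ([s] @ (w @ rev w) @ [s]) ([s] @ [] @ [s])"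
    using Cons by (intro cc_ctxt) auto
  then show ?case
    using Cons cc_trans[OF _ coxeter_cong_square[OF assms(1), of s]] by simp
qed (simp add: cc_refl)

definition reduced_word :: "'a set \<Rightarrow> ('a \<Rightarrow> 'a \<Rightarrow> enat) \<Rightarrow> 'a list \<Rightarrow> bool" where
  "reduced_word S m u \<longleftrightarrow> u \<in> lists S \<and> (\<forall>v. coxeter_cong S m u v \<longrightarrow> length u \<le> length v)"

lemma reduced_word_infix:
  assumes "reduced_word S m (a @ u @ d)"
  shows "reduced_word S m u"
  unfolding reduced_word_def
proof (intro conjI allI impI)
  show "u \<in> lists S" using assms by (auto simp: reduced_word_def)
  fix v assume "coxeter_cong S m u v"
  then have "coxeter_cong S m (a @ u @ d) (a @ v @ d)"
    using assms by (intro cc_ctxt) (auto simp: reduced_word_def)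
  then have "length (a @ u @ d) \<le> length (a @ v @ d)"
    using assms unfolding reduced_word_def by blast
  then show "length u \<le> length v" by simp
qed

lemma reduced_word_cong:
  assumes "reduced_word S m u" "coxeter_cong S m u v" "length v \<le> length u"
  shows "reduced_word S m v"
  unfolding reduced_word_def
proof (intro conjI allI impI)
  show "v \<in> lists S" using assms(1) coxeter_cong_lists[OF assms(2)] by (simp add: reduced_word_def)
  fix w assume "coxeter_cong S m v w"
  then show "length v \<le> length w"
    using assms cc_trans[OF assms(2)] unfolding reduced_word_def by (meson order_trans)
qed

lemma reduced_word_exists:
  assumes "u \<in> lists S"
  shows "\<exists>v. reduced_word S m v \<and> coxeter_cong S m u v"
proof -
  obtain v where v: "coxeter_cong S m u v" "\<forall>w. coxeter_cong S m u w \<longrightarrow> length v \<le> length w"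
    using ex_has_least_nat[of "coxeter_cong S m u" u length] cc_refl by metis
  then have "v \<in> lists S" using assms coxeter_cong_lists by blast
  then show ?thesis
    using v cc_trans[OF v(1)] unfolding reduced_word_def by blast
qed

text \<open>
  Congruent words have lengths of the same parity, so a reduced word that can be shortened at all after
  appending a letter becomes shorter than it was before.
\<close>

lemma not_reduced_word_snoc:
  assumes "reduced_word S m u" "s \<in> S" "\<not> reduced_word S m (u @ [s])"
  shows "\<exists>w. coxeter_cong S m (u @ [s]) w \<and> length w < length u"
proof -
  have "u @ [s] \<in> lists S" using assms by (auto simp: reduced_word_def)
  then obtain w where w: "coxeter_cong S m (u @ [s]) w" "length w < length (u @ [s])"
    using assms(3) unfolding reduced_word_def by (meson not_le)
  then have "length w \<noteq> length u"
    using coxeter_cong_parity[OF w(1)] by auto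
  then show ?thesis using w by auto
qed

lemma reduced_word_two_letters:
  assumes "coxeter_matrix S m" "reduced_word S m d" "set d \<subseteq> {x, y}"
  shows "d = alternating (length d) x y \<or> d = alternating (length d) y x"
  using assms(2,3)
proof (induction d)
  case (Cons a d)
  have red: "reduced_word S m d"
    using Cons.prems reduced_word_infix[of S m "[a]" d "[]"] by simp
  have no_rep: "d = [] \<or> hd d \<noteq> a"
  proof (rule ccontr)
    assume "\<not> ?thesis"
    then obtain d' where "d = a # d'" by (cases d) auto
    then have "reduced_word S m [a, a]"
      using Cons.prems reduced_word_infix[of S m "[]" "[a, a]" d'] by simp
    moreover have "a \<in> S" using Cons.prems by (auto simp: reduced_word_def)
    ultimately show False
      using coxeter_cong_square[OF assms(1)] by (fastforce simp: reduced_word_def)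
  qed
  show ?case
  proof (cases d)
    case Nil
    then show ?thesis using Cons.prems by auto
  next
    case (Cons e d')
    then show ?thesis
      using Cons.IH[OF red] Cons.prems no_rep by auto
  qed
qed auto

text \<open>
  Splitting the relator of length \<open>2 k\<close> as \<open>u v\<close> shows that \<open>u\<close> is congruent to the
  reversal of \<open>v\<close>; for \<open>u\<close> of length \<open>k + 1\<close> the latter has only \<open>k - 1\<close> letters.
\<close>

lemma alternating_not_reduced:
  assumes "coxeter_matrix S m" "x \<in> S" "y \<in> S" "x \<noteq> y" "m x y = enat k" "k < n"
  shows "\<not> reduced_word S m (alternating n x y)"
proof
  assume "reduced_word S m (alternating n x y)"
  moreover obtain w where "alternating n x y = alternating (Suc k) x y @ w"
    using alternating_append[of "Suc k" "n - Suc k" x y] assms by auto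
  ultimately have red: "reduced_word S m (alternating (Suc k) x y)"
    using reduced_word_infix[of S m "[]" _ w] by simp
  have "enat 2 \<le> enat k"
    using assms unfolding coxeter_matrix_def by (metis numeral_eq_enat)
  then have k: "2 \<le> k" by simp
  obtain v where v: "alternating (2 * k) x y = alternating (Suc k) x y @ v"
    using alternating_append[of "Suc k" "k - 1" x y] k by (auto simp: mult_2)
  have lists: "alternating j x y \<in> lists S" for j
  proof -
    have "set (alternating j p q) \<subseteq> {p, q}" for p q :: 'a
      by (induction j arbitrary: p q) auto
    then show ?thesis using assms by blast
  qed
  have vS: "v \<in> lists S" using lists[of "2 * k"] v by auto
  have "coxeter_cong S m (alternating (Suc k) x y @ []) (alternating (Suc k) x y @ (v @ rev v))"
    using coxeter_cong_rev[OF assms(1) vS] lists[of "Suc k"]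
    by (intro coxeter_cong_append cc_refl cc_sym[OF coxeter_cong_rev[OF assms(1) vS]])
      (use vS in \<open>auto simp del: alternating.simps\<close>)
  moreover have "coxeter_cong S m ((alternating (Suc k) x y @ v) @ rev v) ([] @ rev v)"
    using vS cc_rel[of x S y m k, OF assms(2,3,5)]
    by (intro coxeter_cong_append cc_refl)
      (auto simp: v[symmetric] alternating_double simp del: alternating.simps)
  ultimately have "coxeter_cong S m (alternating (Suc k) x y) (rev v)"
    using cc_trans by fastforce
  then have "Suc k \<le> length v"
    using red unfolding reduced_word_def by fastforce
  moreover have "2 * k = Suc k + length v"
    using arg_cong[OF v, of length] by simp
  ultimately show False by simp
qed

section \<open>Positivity of roots\<close>

text \<open>
  Only the values of the form on the simple vectors are prescribed, so that a space containing the
  geometric representation isometrically is an instance.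
\<close>

locale coxeter_form = symmetric_form b for b :: "'v::real_vector \<Rightarrow> 'v \<Rightarrow> real" +
  fixes S :: "'a set" and m :: "'a \<Rightarrow> 'a \<Rightarrow> enat" and \<alpha> :: "'a \<Rightarrow> 'v"
  assumes matrix: "coxeter_matrix S m"
    and fin: "finite S"
    and form_simple: "s \<in> S \<Longrightarrow> t \<in> S \<Longrightarrow> b (\<alpha> s) (\<alpha> t) = simple_form m s t"
begin

definition act :: "'a list \<Rightarrow> 'v \<Rightarrow> 'v" where
  "act u = reflect_word (map \<alpha> u)"

lemma act_simps [simp]: "act [] v = v" "act (s # u) v = reflect (\<alpha> s) (act u v)"
  by (simp_all add: act_def)

lemma act_append: "act (u @ w) v = act u (act w v)"
  by (simp add: act_def reflect_word_append)

lemma linear_act: "linear (act u)"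
  by (simp add: act_def linear_reflect_word)

lemma form_simple_self: "s \<in> S \<Longrightarrow> b (\<alpha> s) (\<alpha> s) = 1"
  using matrix by (simp add: form_simple simple_form_def coxeter_matrix_def one_enat_def)

lemma coxeter_matrix_ge2: "s \<in> S \<Longrightarrow> t \<in> S \<Longrightarrow> s \<noteq> t \<Longrightarrow> m s t = enat k \<Longrightarrow> 2 \<le> k"
  using matrix unfolding coxeter_matrix_def by (metis enat_ord_simps(1) numeral_eq_enat)

lemma act_cong: "coxeter_cong S m u v \<Longrightarrow> act u = act v"
proof (induction rule: coxeter_cong.induct)
  case (cc_rel s t k)
  show ?case
  proof (cases "s = t")
    case True
    then have "k = 1" using cc_rel matrix by (simp add: coxeter_matrix_def one_enat_def)
    then show ?thesis
      using True cc_rel(1) by (simp add: fun_eq_iff reflect_involution form_simple_self)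
  next
    case False
    have "reflect_word (concat (replicate k [\<alpha> s, \<alpha> t])) v = v" for v
      using cc_rel False coxeter_matrix_ge2 form_simple_self
      by (intro reflect_dihedral_relation) (auto simp: form_simple simple_form_def)
    moreover have "map \<alpha> (concat (replicate k [s, t])) = concat (replicate k [\<alpha> s, \<alpha> t])"
      by (simp add: map_concat)
    ultimately show ?thesis
      by (simp add: act_def fun_eq_iff)
  qed
qed (auto simp: fun_eq_iff act_append)

definition cone :: "'v set" where
  "cone = {\<Sum>r\<in>S. a r *\<^sub>R \<alpha> r |a. \<forall>r. 0 \<le> a r}"

lemma cone_add: "u \<in> cone \<Longrightarrow> v \<in> cone \<Longrightarrow> u + v \<in> cone"
proof -
  assume "u \<in> cone" "v \<in> cone"
  then obtain a d where "u = (\<Sum>r\<in>S. a r *\<^sub>R \<alpha> r)" "v = (\<Sum>r\<in>S. d r *\<^sub>R \<alpha> r)"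
    and "\<forall>r. 0 \<le> a r" "\<forall>r. 0 \<le> d r"
    by (auto simp: cone_def)
  then show ?thesis
    unfolding cone_def
    by (intro CollectI exI[of _ "\<lambda>r. a r + d r"]) (auto simp: scaleR_add_left sum.distrib)
qed

lemma cone_scale: "u \<in> cone \<Longrightarrow> 0 \<le> e \<Longrightarrow> e *\<^sub>R u \<in> cone"
proof -
  assume "u \<in> cone" and e: "0 \<le> e"
  then obtain a where "u = (\<Sum>r\<in>S. a r *\<^sub>R \<alpha> r)" "\<forall>r. 0 \<le> a r"
    by (auto simp: cone_def)
  then show ?thesis
    using e unfolding cone_def
    by (intro CollectI exI[of _ "\<lambda>r. e * a r"]) (auto simp: scaleR_sum_right)
qed

lemma simple_in_cone: "s \<in> S \<Longrightarrow> \<alpha> s \<in> cone"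
proof -
  assume s: "s \<in> S"
  have "(\<Sum>r\<in>S. (if r = s then 1 else 0) *\<^sub>R \<alpha> r) = (\<Sum>r\<in>S. if r = s then \<alpha> r else 0)"
    by (intro sum.cong) auto
  then have "\<alpha> s = (\<Sum>r\<in>S. (if r = s then 1 else 0) *\<^sub>R \<alpha> r)"
    using s fin by (simp add: sum.delta)
  then show ?thesis unfolding cone_def by (intro CollectI exI[of _ "\<lambda>r. if r = s then 1 else 0"]) auto
qed

text \<open>
  A reduced word in two letters is alternating and has at most \<open>m s t\<close> letters, so the
  dihedral coefficients that describe its action are nonnegative.
\<close>

lemma act_simple_two_letters:
  assumes "reduced_word S m (d @ [s])" "set d \<subseteq> {s, t}" "s \<in> S" "t \<in> S" "s \<noteq> t"
  shows "\<exists>e f. 0 \<le> e \<and> 0 \<le> f \<and> act d (\<alpha> s) = e *\<^sub>R \<alpha> s + f *\<^sub>R \<alpha> t"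
proof -
  let ?n = "length d"
  obtain p q where pq: "d @ [s] = alternating (Suc ?n) p q" "(p = s \<and> q = t) \<or> (p = t \<and> q = s)"
    using reduced_word_two_letters[OF matrix assms(1), of s t] assms(2) by auto
  then have d: "d = alternating ?n p q" "s = (if even ?n then p else q)"
    unfolding alternating_snoc by auto
  have pqS: "p \<in> S" "q \<in> S" "p \<noteq> q" using pq assms by auto
  define c where "c = - simple_form m p q"
  have "act d (\<alpha> s) = reflect_word (alternating ?n (\<alpha> p) (\<alpha> q)) (if even ?n then \<alpha> p else \<alpha> q)"
    using arg_cong[OF d(1), of act] d(2) by (cases "even ?n") (simp_all add: act_def map_alternating)
  also have "\<dots> = dihedral_coeff c (Suc ?n) *\<^sub>R \<alpha> p + dihedral_coeff c ?n *\<^sub>R \<alpha> q"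
    using pqS form_simple_self by (intro reflect_alternating) (auto simp: c_def form_simple)
  finally have eq: "act d (\<alpha> s) = dihedral_coeff c (Suc ?n) *\<^sub>R \<alpha> p + dihedral_coeff c ?n *\<^sub>R \<alpha> q" .
  have "0 \<le> dihedral_coeff c j" if j: "j \<le> Suc ?n" for j
  proof (cases "m p q")
    case (enat k)
    have "Suc ?n \<le> k"
      using alternating_not_reduced[OF matrix pqS enat, of "Suc ?n"] assms(1) unfolding pq(1)
      by (meson not_le)
    then show ?thesis
      using dihedral_coeff_nonneg[OF coxeter_matrix_ge2[OF pqS enat], of j] j
      by (simp add: c_def simple_form_def enat)
  next
    case infinity
    then show ?thesis by (simp add: c_def simple_form_def dihedral_coeff_one)
  qed
  then have nonneg: "0 \<le> dihedral_coeff c (Suc ?n)" "0 \<le> dihedral_coeff c ?n" by auto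
  from pq(2) show ?thesis
  proof
    assume "p = s \<and> q = t"
    then show ?thesis using eq nonneg by blast
  next
    assume "p = t \<and> q = s"
    then have "act d (\<alpha> s) = dihedral_coeff c ?n *\<^sub>R \<alpha> s + dihedral_coeff c (Suc ?n) *\<^sub>R \<alpha> t"
      using eq by (simp add: add.commute)
    then show ?thesis using nonneg by blast
  qed
qed

text \<open>
  If \<open>u s\<close> is reduced, then \<open>u\<close> sends the simple root of \<open>s\<close> to a nonnegative combination of
  simple roots. The classical induction on length splits off a maximal dihedral factor: with \<open>t\<close> the last
  letter of \<open>u\<close>, write \<open>u\<close> as \<open>v d\<close> without loss of length, where \<open>d\<close> uses only \<open>s\<close>
  and \<open>t\<close>, and \<open>v\<close> is as short as possible. By minimality both \<open>v s\<close> and \<open>v t\<close> are reduced, so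
  the induction hypothesis handles \<open>v\<close>, while \<open>d\<close> is handled in rank two.
\<close>

lemma act_simple_positive:
  assumes "reduced_word S m (u @ [s])"
  shows "act u (\<alpha> s) \<in> cone"
  using assms
proof (induction "length u" arbitrary: u s rule: less_induct)
  case less
  have sS: "s \<in> S" and uS: "u \<in> lists S" and red_u: "reduced_word S m u"
    using less.prems reduced_word_infix[of S m "[]" u "[s]"] by (auto simp: reduced_word_def)
  show ?case
  proof (cases u rule: rev_cases)
    case Nil
    then show ?thesis using simple_in_cone[OF sS] by simp
  next
    case (snoc u' t)
    have tS: "t \<in> S" using uS snoc by auto
    have "s \<noteq> t"
    proof
      assume "s = t"
      then have "reduced_word S m [s, s]"
        using less.prems snoc reduced_word_infix[of S m u' "[s, s]" "[]"] by simp
      then show False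
        using coxeter_cong_square[OF matrix sS] by (fastforce simp: reduced_word_def)
    qed
    define P where "P v \<longleftrightarrow> (\<exists>d. v \<in> lists S \<and> set d \<subseteq> {s, t} \<and>
        coxeter_cong S m (v @ d) u \<and> length v + length d = length u)" for v
    have "P u'"
      unfolding P_def using uS snoc cc_refl by (intro exI[of _ "[t]"]) auto
    then obtain v where "P v" and v_min: "\<And>w. P w \<Longrightarrow> length v \<le> length w"
      using ex_has_least_nat[of P u' length] by auto
    then obtain d where vS: "v \<in> lists S" and d: "set d \<subseteq> {s, t}"
      and cong: "coxeter_cong S m (v @ d) u" and len: "length v + length d = length u"
      by (auto simp: P_def)
    have dS: "d \<in> lists S" using d sS tS by auto
    have v_short: "length v < length u"
      using v_min[OF \<open>P u'\<close>] snoc by simp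
    have red_vd: "reduced_word S m (v @ d)"
      using reduced_word_cong[OF red_u cc_sym[OF cong]] len by simp
    have red_v: "reduced_word S m v"
      using reduced_word_infix[of S m "[]" v d] red_vd by simp
    \<comment> \<open>If \<open>v r\<close> were not reduced, the letter \<open>r\<close> could be moved from \<open>v\<close> to \<open>d\<close>.\<close>
    have pos: "act v (\<alpha> r) \<in> cone" if r: "r \<in> {s, t}" for r
    proof (rule less.hyps[OF v_short], rule ccontr)
      have rS: "r \<in> S" using r sS tS by auto
      assume "\<not> reduced_word S m (v @ [r])"
      then obtain w where w: "coxeter_cong S m (v @ [r]) w" "length w < length v"
        using not_reduced_word_snoc[OF red_v rS] by blast
      have wS: "w \<in> lists S" using coxeter_cong_lists[OF w(1)] vS rS by auto
      have "coxeter_cong S m (w @ r # d) ((v @ [r]) @ r # d)"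
        using w wS vS rS dS by (intro coxeter_cong_append cc_refl cc_sym[OF w(1)]) auto
      moreover have "coxeter_cong S m (v @ [r, r] @ d) (v @ [] @ d)"
        using coxeter_cong_square[OF matrix rS] vS dS by (intro cc_ctxt)
      ultimately have c: "coxeter_cong S m (w @ r # d) u"
        using cc_trans[OF cc_trans[of S m "w @ r # d" "v @ [r, r] @ d" "v @ d"] cong] by simp
      have "length u \<le> length (w @ r # d)"
        using red_u cc_sym[OF c] unfolding reduced_word_def by blast
      then have "P w"
        unfolding P_def using w(2) wS c d r len by (intro exI[of _ "r # d"]) auto
      then show False using v_min w(2) by fastforce
    qed
    have "coxeter_cong S m (u @ [s]) ((v @ d) @ [s])"
      using cong vS dS sS by (intro coxeter_cong_append cc_refl cc_sym[OF cong]) auto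
    then have "reduced_word S m ((v @ d) @ [s])"
      using reduced_word_cong[OF less.prems] len by simp
    then have "reduced_word S m (d @ [s])"
      using reduced_word_infix[of S m v "d @ [s]" "[]"] by simp
    then obtain e f where ef: "0 \<le> e" "0 \<le> f" "act d (\<alpha> s) = e *\<^sub>R \<alpha> s + f *\<^sub>R \<alpha> t"
      using act_simple_two_letters[OF _ d sS tS \<open>s \<noteq> t\<close>] by blast
    have "act u (\<alpha> s) = act v (act d (\<alpha> s))"
      using act_cong[OF cong] by (metis act_append)
    also have "\<dots> = e *\<^sub>R act v (\<alpha> s) + f *\<^sub>R act v (\<alpha> t)"
      by (simp add: ef linear_add[OF linear_act] linear_scale[OF linear_act])
    finally show ?thesis
      using cone_add[OF cone_scale[OF pos[of s] ef(1)] cone_scale[OF pos[of t] ef(2)]] by simp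
  qed
qed

text \<open>
  The dichotomy between positive and negative roots: if \<open>v s\<close> is not reduced, then \<open>v\<close> is congruent to
  a reduced word \<open>w s\<close>, and the last letter \<open>s\<close> negates its own root.
\<close>

lemma act_simple_sign:
  assumes "u \<in> lists S" "s \<in> S"
  shows "act u (\<alpha> s) \<in> cone \<or> - act u (\<alpha> s) \<in> cone"
proof -
  obtain v where v: "reduced_word S m v" "coxeter_cong S m u v"
    using reduced_word_exists[OF assms(1)] by blast
  have uv: "act u = act v" by (rule act_cong[OF v(2)])
  show ?thesis
  proof (cases "reduced_word S m (v @ [s])")
    case True
    then show ?thesis using act_simple_positive uv by simp
  next
    case False
    then obtain w where w: "coxeter_cong S m (v @ [s]) w" "length w < length v"
      using not_reduced_word_snoc[OF v(1) assms(2)] by blast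
    have vS: "v \<in> lists S" using v by (simp add: reduced_word_def)
    have wS: "w \<in> lists S" using coxeter_cong_lists[OF w(1)] vS assms by auto
    have "coxeter_cong S m ((v @ [s]) @ [s]) (w @ [s])"
      using w wS assms by (intro coxeter_cong_append cc_refl) auto
    moreover have "coxeter_cong S m (v @ [s, s] @ []) (v @ [] @ [])"
      using coxeter_cong_square[OF matrix assms(2)] vS by (intro cc_ctxt) auto
    ultimately have c: "coxeter_cong S m v (w @ [s])"
      using cc_trans[OF cc_sym[of S m "v @ [s, s]" v]] by simp
    have "act w (\<alpha> s) \<in> cone"
      using reduced_word_cong[OF v(1) c] w(2) by (intro act_simple_positive) auto
    moreover have "act v (\<alpha> s) = - act w (\<alpha> s)"
      using act_cong[OF c] linear_act[of w] form_simple_self[OF assms(2)]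
      by (simp add: act_append reflect_self linear_neg)
    ultimately show ?thesis using uv by simp
  qed
qed

end

section \<open>The extended geometric representation\<close>

lemma lookup_scaleR [simp]: "Poly_Mapping.lookup (a *\<^sub>R v) s = a * Poly_Mapping.lookup v s"
  for v :: "'a \<Rightarrow>\<^sub>0 real"
proof -
  have "finite {i. a *\<^sub>R Poly_Mapping.lookup v i \<noteq> 0}"
    by (rule finite_subset[OF _ finite_lookup[of v]]) auto
  then show ?thesis by (simp add: scaleR_poly_mapping_def)
qed

lemma geom_space_iff: "v \<in> geom_space S \<longleftrightarrow> (\<forall>s. s \<notin> S \<longrightarrow> Poly_Mapping.lookup v s = 0)"
  by (auto simp: geom_space_def in_keys_iff)

lemma geom_space_sub_scale:
  "u \<in> geom_space S \<Longrightarrow> v \<in> geom_space S \<Longrightarrow> u - a *\<^sub>R v \<in> geom_space S"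
  by (simp add: geom_space_iff lookup_minus)

lemma simple_root_in_geom_space: "s \<in> S \<Longrightarrow> simple_root s \<in> geom_space S"
  by (simp add: geom_space_def simple_root_def)

lemma lookup_simple_root: "Poly_Mapping.lookup (simple_root s) r = (if r = s then 1 else 0)"
  by (simp add: simple_root_def lookup_single when_def)

lemma lookup_simple_root_sum:
  assumes "finite S"
  shows "Poly_Mapping.lookup (\<Sum>s\<in>S. h s *\<^sub>R simple_root s) r = (if r \<in> S then h r else 0)"
proof -
  have "Poly_Mapping.lookup (\<Sum>s\<in>S. h s *\<^sub>R simple_root s) r = (\<Sum>s\<in>S. if r = s then h s else 0)"
    by (auto simp: lookup_sum lookup_simple_root intro!: sum.cong)
  then show ?thesis using assms by (simp add: sum.delta')
qed

lemma geom_space_expand: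
  assumes "finite S" "v \<in> geom_space S"
  shows "v = (\<Sum>s\<in>S. Poly_Mapping.lookup v s *\<^sub>R simple_root s)"
  using assms by (intro poly_mapping_eqI) (auto simp: lookup_simple_root_sum geom_space_iff)

lemma independent_simple_roots:
  assumes "finite S"
  shows "independent (simple_root ` S)"
proof (rule independent_if_scalars_zero)
  fix f :: "('a \<Rightarrow>\<^sub>0 real) \<Rightarrow> real" and x
  assume zero: "(\<Sum>x\<in>simple_root ` S. f x *\<^sub>R x) = 0" and "x \<in> simple_root ` S"
  then obtain s where s: "s \<in> S" "x = simple_root s" by blast
  have "inj_on simple_root S"
    using lookup_simple_root by (metis inj_onI zero_neq_one)
  then have "(\<Sum>s\<in>S. f (simple_root s) *\<^sub>R simple_root s) = 0"
    using zero by (simp add: sum.reindex)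
  then have "Poly_Mapping.lookup (\<Sum>s\<in>S. f (simple_root s) *\<^sub>R simple_root s) s = 0" by simp
  then show "f x = 0" using s by (simp add: lookup_simple_root_sum[OF assms])
qed (use assms in simp)

text \<open>
  The form on \<open>V \<times> V\<^sup>*\<close> that extends the geometric form on \<open>V\<close> by the pairing between \<open>V\<close> and its
  dual, with the dual written in the basis dual to the simple roots and isotropic. Whatever the radical of
  the geometric form, every functional on \<open>V\<close> is represented by a vector of the second factor.
  Summing over \<open>S\<close> instead of the supports makes it bilinear and symmetric on the whole type.
\<close>

definition extended_form ::
  "'a set \<Rightarrow> ('a \<Rightarrow> 'a \<Rightarrow> enat) \<Rightarrow> ('a \<Rightarrow>\<^sub>0 real) \<times> ('a \<Rightarrow>\<^sub>0 real) \<Rightarrow> ('a \<Rightarrow>\<^sub>0 real) \<times> ('a \<Rightarrow>\<^sub>0 real) \<Rightarrow> real"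
  where
  "extended_form S m y z =
     (\<Sum>s\<in>S. \<Sum>t\<in>S. Poly_Mapping.lookup (fst y) s * Poly_Mapping.lookup (fst z) t * simple_form m s t) +
     (\<Sum>s\<in>S. Poly_Mapping.lookup (fst y) s * Poly_Mapping.lookup (snd z) s +
              Poly_Mapping.lookup (snd y) s * Poly_Mapping.lookup (fst z) s)"

lemma extended_form_geom:
  assumes "finite S" "u \<in> geom_space S" "v \<in> geom_space S"
  shows "extended_form S m (u, 0) (v, 0) = geom_form m u v"
proof -
  have "(\<Sum>s\<in>S. \<Sum>t\<in>S. Poly_Mapping.lookup u s * Poly_Mapping.lookup v t * simple_form m s t) =
      (\<Sum>s\<in>Poly_Mapping.keys u. \<Sum>t\<in>S. Poly_Mapping.lookup u s * Poly_Mapping.lookup v t * simple_form m s t)"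
    using assms by (intro sum.mono_neutral_right) (auto simp: geom_space_def in_keys_iff)
  also have "\<dots> = geom_form m u v"
    unfolding geom_form_def
    using assms by (intro sum.cong refl sum.mono_neutral_right) (auto simp: geom_space_def in_keys_iff)
  finally show ?thesis by (simp add: extended_form_def)
qed

lemma coxeter_matrix_simple_form_sym:
  "coxeter_matrix S m \<Longrightarrow> s \<in> S \<Longrightarrow> t \<in> S \<Longrightarrow> simple_form m s t = simple_form m t s"
  by (simp add: simple_form_def coxeter_matrix_def)

lemma symmetric_form_extended:
  assumes "coxeter_matrix S m"
  shows "symmetric_form (extended_form S m)"
proof
  fix x y z :: "('a \<Rightarrow>\<^sub>0 real) \<times> ('a \<Rightarrow>\<^sub>0 real)" and a :: real
  show "extended_form S m (x + y) z = extended_form S m x z + extended_form S m y z"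
    by (simp add: extended_form_def lookup_add algebra_simps sum.distrib)
  show "extended_form S m (a *\<^sub>R x) z = a * extended_form S m x z"
    by (simp add: extended_form_def algebra_simps sum.distrib sum_distrib_left)
  have "(\<Sum>s\<in>S. \<Sum>t\<in>S. Poly_Mapping.lookup (fst x) s * Poly_Mapping.lookup (fst y) t * simple_form m s t) =
     (\<Sum>t\<in>S. \<Sum>s\<in>S. Poly_Mapping.lookup (fst x) s * Poly_Mapping.lookup (fst y) t * simple_form m s t)"
    by (rule sum.swap)
  also have "\<dots> = (\<Sum>t\<in>S. \<Sum>s\<in>S. Poly_Mapping.lookup (fst y) t * Poly_Mapping.lookup (fst x) s * simple_form m t s)"
    using coxeter_matrix_simple_form_sym[OF assms] by (intro sum.cong refl) auto
  finally show "extended_form S m x y = extended_form S m y x"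
    by (simp add: extended_form_def algebra_simps)
qed

section \<open>Independent lists\<close>

lemma internal_direct_sum_independent:
  fixes bs :: "'v::real_vector list"
  assumes "distinct bs" "independent (set bs)"
  shows "internal_direct_sum (span (set bs)) (map (\<lambda>\<beta>. span {\<beta>}) bs)"
proof -
  let ?n = "length bs"
  have bij: "bij_betw ((!) bs) {..<?n} (set bs)"
    using bij_betw_nth[OF assms(1)] by simp
  define idx where "idx = the_inv_into {..<?n} ((!) bs)"
  have idx: "idx (bs ! i) = i" if "i < ?n" for i
    using bij that by (auto simp: idx_def bij_betw_def intro!: the_inv_into_f_f)
  have reindex: "(\<Sum>i<?n. u i *\<^sub>R bs ! i) = (\<Sum>\<beta>\<in>set bs. u (idx \<beta>) *\<^sub>R \<beta>)" for u :: "nat \<Rightarrow> real"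
    using sum.reindex_bij_betw[OF bij, of "\<lambda>\<beta>. u (idx \<beta>) *\<^sub>R \<beta>"] idx by simp
  let ?P = "\<Pi>\<^sub>E i\<in>{..<?n}. span {bs ! i}"
  let ?f = "\<lambda>f. \<Sum>i<?n. f i"
  have P_eq: "(\<Pi>\<^sub>E i\<in>{..<?n}. map (\<lambda>\<beta>. span {\<beta>}) bs ! i) = ?P"
    by (intro PiE_cong) auto
  have coeffs: "\<exists>u. \<forall>i<?n. f i = u i *\<^sub>R bs ! i" if "f \<in> ?P" for f
  proof -
    have "\<forall>i. \<exists>k. i < ?n \<longrightarrow> f i = k *\<^sub>R bs ! i"
      using that by (auto simp: PiE_iff span_singleton)
    then show ?thesis by metis
  qed
  have "inj_on ?f ?P"
  proof (rule inj_onI)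
    fix f g assume f: "f \<in> ?P" and g: "g \<in> ?P" and eq: "?f f = ?f g"
    obtain u w where u: "\<forall>i<?n. f i = u i *\<^sub>R bs ! i" and w: "\<forall>i<?n. g i = w i *\<^sub>R bs ! i"
      using coeffs[OF f] coeffs[OF g] by blast
    have "(\<Sum>i<?n. (u i - w i) *\<^sub>R bs ! i) = ?f f - ?f g"
      using u w by (simp add: scaleR_diff_left sum_subtractf)
    then have "(\<Sum>\<beta>\<in>set bs. (u (idx \<beta>) - w (idx \<beta>)) *\<^sub>R \<beta>) = 0"
      using reindex[of "\<lambda>i. u i - w i"] eq by simp
    then have "u (idx (bs ! i)) - w (idx (bs ! i)) = 0" if "i < ?n" for i
      using independentD[OF assms(2) finite_set subset_refl, of "\<lambda>\<beta>. u (idx \<beta>) - w (idx \<beta>)"] that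
      by auto
    then have "f i = g i" if "i < ?n" for i
      using u w that by (simp add: idx)
    then show "f = g"
      using f g by (intro PiE_ext[of f _ _ g]) auto
  qed
  moreover have "?f ` ?P = span (set bs)"
  proof
    show "?f ` ?P \<subseteq> span (set bs)"
    proof (intro image_subsetI span_sum)
      fix f i assume "f \<in> ?P" "i \<in> {..<?n}"
      then have "f i \<in> span {bs ! i}" by (auto simp: PiE_iff)
      then show "f i \<in> span (set bs)"
        using \<open>i \<in> {..<?n}\<close> span_mono[of "{bs ! i}" "set bs"] by auto
    qed
    show "span (set bs) \<subseteq> ?f ` ?P"
    proof
      fix v assume "v \<in> span (set bs)"
      then obtain h where "v = (\<Sum>\<beta>\<in>set bs. h \<beta> *\<^sub>R \<beta>)"
        by (auto simp: span_finite)
      then have "v = (\<Sum>i<?n. h (bs ! i) *\<^sub>R bs ! i)"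
        using sum.reindex_bij_betw[OF bij, of "\<lambda>\<beta>. h \<beta> *\<^sub>R \<beta>"] by simp
      then have "v = ?f (\<lambda>i\<in>{..<?n}. h (bs ! i) *\<^sub>R bs ! i)"
        by simp
      moreover have "(\<lambda>i\<in>{..<?n}. h (bs ! i) *\<^sub>R bs ! i) \<in> ?P"
        by (auto intro: span_scale span_base)
      ultimately show "v \<in> ?f ` ?P" by blast
    qed
  qed
  ultimately show ?thesis
    unfolding internal_direct_sum_def by (auto simp: P_eq bij_betw_def)
qed

text \<open>
  Deleting a redundant entry would leave a spanning list with fewer entries than \<open>A\<close> has elements.
\<close>

lemma spanning_list_independent:
  fixes bs :: "'v::real_vector list"
  assumes "independent A" "A \<subseteq> span (set bs)" "length bs \<le> card A"
  shows "distinct bs \<and> independent (set bs)"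
proof -
  have "card A \<le> card (set bs)"
    using independent_span_bound[of "set bs" A] assms by auto
  then have card: "card (set bs) = length bs" "card (set bs) = card A"
    using card_length[of bs] assms(3) by auto
  have "independent (set bs)"
  proof
    assume "dependent (set bs)"
    then obtain a where a: "a \<in> set bs" "a \<in> span (set bs - {a})"
      by (auto simp: dependent_def)
    have "span (set bs) = span (set bs - {a})"
      using span_redundant[OF a(2)] a(1) by (simp add: insert_absorb)
    then have "card A \<le> card (set bs - {a})"
      using independent_span_bound[of "set bs - {a}" A] assms by auto
    moreover have "card (set bs - {a}) < card (set bs)"
      using a(1) by (intro card_Diff1_less) auto
    ultimately show False using card by simp
  qed
  then show ?thesis using card(1) card_distinct by blast
qed

lemma linear_pair_zero: "linear (\<lambda>v::'v::real_vector. (v, 0::'w::real_vector))"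
  by (rule linearI) auto

lemma span_pair_zero: "(v, 0) \<in> span ((\<lambda>v. (v, 0)) ` A) \<longleftrightarrow> v \<in> span A"
  for v :: "'v::real_vector"
  using linear_span_image[OF linear_pair_zero, of A] by auto

lemma independent_pair_zero: "independent ((\<lambda>v. (v, 0::'w::real_vector)) ` A) \<longleftrightarrow> independent A"
  for A :: "'v::real_vector set"
proof
  assume A: "independent ((\<lambda>v. (v, 0::'w)) ` A)"
  show "independent A"
  proof
    assume "dependent A"
    then obtain a where a: "a \<in> A" "a \<in> span (A - {a})" by (auto simp: dependent_def)
    then have "(a, 0::'w) \<in> span ((\<lambda>v. (v, 0)) ` (A - {a}))"
      by (simp add: span_pair_zero)
    moreover have "(\<lambda>v. (v, 0::'w)) ` (A - {a}) = (\<lambda>v. (v, 0)) ` A - {(a, 0)}" by auto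
    ultimately show False using A a(1) by (auto simp: dependent_def)
  qed
next
  assume "independent A"
  then show "independent ((\<lambda>v. (v, 0::'w)) ` A)"
    by (intro linear_independent_injective_image[OF linear_pair_zero]) (auto simp: inj_on_def)
qed

section \<open>The action of the group and the root of a reflection\<close>

locale finite_rank_coxeter_system =
  fixes G :: "('a, 'b) monoid_scheme" (structure) and S :: "'a set" and m :: "'a \<Rightarrow> 'a \<Rightarrow> enat"
  assumes system: "coxeter_system G S m" and finite_S: "finite S"
begin

abbreviation embed :: "('a \<Rightarrow>\<^sub>0 real) \<Rightarrow> ('a \<Rightarrow>\<^sub>0 real) \<times> ('a \<Rightarrow>\<^sub>0 real)" where
  "embed v \<equiv> (v, 0)"

lemma coxeter_matrix: "coxeter_matrix S m"
  using system by (simp add: coxeter_system_def)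

end

sublocale finite_rank_coxeter_system \<subseteq> group G
  using system by (simp add: coxeter_system_def)

sublocale finite_rank_coxeter_system \<subseteq> coxeter_form "extended_form S m" S m "\<lambda>s. embed (simple_root s)"
proof -
  interpret symmetric_form "extended_form S m"
    by (rule symmetric_form_extended[OF coxeter_matrix])
  show "coxeter_form (extended_form S m) S m (\<lambda>s. embed (simple_root s))"
  proof
    fix s t assume st: "s \<in> S" "t \<in> S"
    have "extended_form S m (embed (simple_root s)) (embed (simple_root t)) =
        geom_form m (simple_root s) (simple_root t)"
      by (rule extended_form_geom[OF finite_S]) (use st in \<open>auto intro: simple_root_in_geom_space\<close>)
    then show "extended_form S m (embed (simple_root s)) (embed (simple_root t)) = simple_form m s t"
      by (simp add: geom_form_def simple_root_def)
  qed (use coxeter_matrix finite_S in auto)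
qed

context finite_rank_coxeter_system
begin

abbreviation T :: "'a set" where "T \<equiv> reflections G S"
abbreviation \<l> :: "'a \<Rightarrow> nat" where "\<l> \<equiv> refl_length G S"
abbreviation root :: "'a \<Rightarrow> ('a \<Rightarrow>\<^sub>0 real)" where "root \<equiv> root_of G S m"

text \<open>
  A functional that is 1 at \<open>\<beta>\<close> and 0 on \<open>X\<close> exists by independence; its coordinates on the
  simple roots give a vector of the dual factor that represents it on all of \<open>V\<close>.
\<close>

lemma separates_geom_space: "separates (embed ` geom_space S)"
  unfolding separates_def
proof (intro allI impI)
  fix \<beta> X
  assume sub: "insert \<beta> X \<subseteq> embed ` geom_space S" and \<beta>: "\<beta> \<notin> X" and ind: "independent (insert \<beta> X)"
  obtain g :: "('a \<Rightarrow>\<^sub>0 real) \<times> ('a \<Rightarrow>\<^sub>0 real) \<Rightarrow> real"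
    where g: "linear g" "\<forall>x\<in>insert \<beta> X. g x = (if x = \<beta> then 1 else 0)"
    using linear_independent_extend[OF ind, of "\<lambda>x. if x = \<beta> then 1 else 0"] by blast
  define z :: "('a \<Rightarrow>\<^sub>0 real) \<times> ('a \<Rightarrow>\<^sub>0 real)"
    where "z = (0, \<Sum>s\<in>S. g (embed (simple_root s)) *\<^sub>R simple_root s)"
  have "extended_form S m (embed v) z = g (embed v)" if v: "v \<in> geom_space S" for v
  proof -
    have L: "linear (\<lambda>v. g (embed v))"
      using linear_compose[OF linear_pair_zero g(1)] by (simp add: o_def)
    then have "g (embed (\<Sum>s\<in>S. Poly_Mapping.lookup v s *\<^sub>R simple_root s)) =
        (\<Sum>s\<in>S. Poly_Mapping.lookup v s * g (embed (simple_root s)))"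
      by (simp add: linear_sum[OF L] linear_scale[OF L, simplified])
    then have "g (embed v) = (\<Sum>s\<in>S. Poly_Mapping.lookup v s * g (embed (simple_root s)))"
      using geom_space_expand[OF finite_S v] by simp
    then show ?thesis
      by (simp add: extended_form_def z_def lookup_simple_root_sum[OF finite_S])
  qed
  then have "\<forall>\<gamma>\<in>embed ` geom_space S. extended_form S m \<gamma> z = g \<gamma>" by simp
  then have "extended_form S m \<gamma> z = g \<gamma>" if "\<gamma> \<in> insert \<beta> X" for \<gamma>
    using subsetD[OF sub that] by (rule bspec)
  then show "\<exists>z. extended_form S m \<beta> z = 1 \<and> (\<forall>\<gamma>\<in>X. extended_form S m \<gamma> z = 0)"
    using g(2) \<beta> by (intro exI[of _ z]) auto
qed

lemma word_prod_Nil [simp]: "word_prod G [] = \<one>"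
  and word_prod_Cons [simp]: "word_prod G (x # xs) = x \<otimes> word_prod G xs"
  by (simp_all add: word_prod_def)

lemma word_prod_closed [simp]: "xs \<in> lists (carrier G) \<Longrightarrow> word_prod G xs \<in> carrier G"
  by (induction xs) auto

lemma word_prod_append:
  "xs \<in> lists (carrier G) \<Longrightarrow> ys \<in> lists (carrier G) \<Longrightarrow>
    word_prod G (xs @ ys) = word_prod G xs \<otimes> word_prod G ys"
  by (induction xs) (auto simp: m_assoc)

lemma word_prod_conjugate:
  assumes "g \<in> carrier G" "xs \<in> lists (carrier G)"
  shows "word_prod G (map (\<lambda>x. g \<otimes> x \<otimes> inv g) xs) = g \<otimes> word_prod G xs \<otimes> inv g"
  using assms(2)
proof (induction xs)
  case (Cons x xs)
  then have "word_prod G xs \<in> carrier G" by auto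
  moreover have "inv g \<otimes> (g \<otimes> z) = z" if "z \<in> carrier G" for z
    using assms(1) that by (simp add: m_assoc[symmetric])
  ultimately show ?case
    using Cons assms(1) by (simp add: m_assoc)
qed (use assms in simp)

lemma S_carrier: "S \<subseteq> carrier G"
  using system by (simp add: coxeter_system_def)

lemma S_lists_carrier: "u \<in> lists S \<Longrightarrow> u \<in> lists (carrier G)"
  using S_carrier by auto

lemma word_prod_eq_iff:
  "u \<in> lists S \<Longrightarrow> v \<in> lists S \<Longrightarrow> word_prod G u = word_prod G v \<longleftrightarrow> coxeter_cong S m u v"
  using system unfolding coxeter_system_def by blast

lemma word_prod_rev:
  assumes "u \<in> lists S"
  shows "word_prod G (rev u) = inv (word_prod G u)"
proof -
  have u: "u \<in> lists (carrier G)" "rev u \<in> lists (carrier G)" using assms S_carrier by auto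
  have "word_prod G (u @ rev u) = word_prod G []"
    using coxeter_cong_rev[OF coxeter_matrix assms] assms by (subst word_prod_eq_iff) auto
  then have "word_prod G u \<otimes> word_prod G (rev u) = \<one>"
    using u by (simp add: word_prod_append)
  then show ?thesis
    using u by (metis inv_equality inv_inv word_prod_closed inv_closed)
qed

lemma word_exists:
  assumes "w \<in> carrier G"
  shows "\<exists>u. u \<in> lists S \<and> word_prod G u = w"
proof -
  have "w \<in> generate G S" using assms system by (simp add: coxeter_system_def)
  then show ?thesis
  proof (induction rule: generate.induct)
    case one
    show ?case by (intro exI[of _ "[]"]) simp
  next
    case (incl s)
    then show ?case using S_carrier by (intro exI[of _ "[s]"]) auto
  next
    case (inv s)
    then show ?case using S_carrier word_prod_rev[of "[s]"] by (intro exI[of _ "[s]"]) auto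
  next
    case (eng g h)
    then obtain u v where "u \<in> lists S" "word_prod G u = g" "v \<in> lists S" "word_prod G v = h" by blast
    then show ?case
      using S_lists_carrier by (intro exI[of _ "u @ v"]) (auto simp: word_prod_append)
  qed
qed

text \<open>
  The word through which \<open>geom_action\<close> lets \<open>w\<close> act, so that the action on the enlarged
  space restricts to \<open>geom_action\<close> by construction.
\<close>

definition word_of :: "'a \<Rightarrow> 'a list" where
  "word_of w = (SOME u. u \<in> lists S \<and> word_prod G u = w)"

lemma word_of: "w \<in> carrier G \<Longrightarrow> word_of w \<in> lists S \<and> word_prod G (word_of w) = w"
  unfolding word_of_def by (rule someI_ex[OF word_exists])

definition rep :: "'a \<Rightarrow> ('a \<Rightarrow>\<^sub>0 real) \<times> ('a \<Rightarrow>\<^sub>0 real) \<Rightarrow> ('a \<Rightarrow>\<^sub>0 real) \<times> ('a \<Rightarrow>\<^sub>0 real)" where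
  "rep w = act (word_of w)"

lemma rep_word_prod: "u \<in> lists S \<Longrightarrow> rep (word_prod G u) = act u"
  unfolding rep_def
  by (rule act_cong) (use word_of[of "word_prod G u"] S_lists_carrier in \<open>auto simp: word_prod_eq_iff[symmetric]\<close>)

lemma rep_one [simp]: "rep \<one> v = v"
  using rep_word_prod[of "[]"] by simp

lemma rep_mult: "g \<in> carrier G \<Longrightarrow> h \<in> carrier G \<Longrightarrow> rep (g \<otimes> h) v = rep g (rep h v)"
proof -
  assume gh: "g \<in> carrier G" "h \<in> carrier G"
  then have "g \<otimes> h = word_prod G (word_of g @ word_of h)"
    using word_of S_lists_carrier by (simp add: word_prod_append)
  then have "rep (g \<otimes> h) = act (word_of g @ word_of h)"
    using rep_word_prod[of "word_of g @ word_of h"] word_of gh by auto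
  then show ?thesis by (simp add: act_append rep_def)
qed

lemma reflect_embed:
  assumes "\<beta> \<in> geom_space S" "v \<in> geom_space S"
  shows "reflect (embed \<beta>) (embed v) = embed (geom_reflection m \<beta> v)"
  using assms by (simp add: reflect_def geom_reflection_def extended_form_geom[OF finite_S])

lemma geom_reflection_in_geom_space:
  "\<beta> \<in> geom_space S \<Longrightarrow> v \<in> geom_space S \<Longrightarrow> geom_reflection m \<beta> v \<in> geom_space S"
  by (simp add: geom_reflection_def geom_space_sub_scale)

lemma act_embed:
  assumes "u \<in> lists S" "v \<in> geom_space S"
  shows "act u (embed v) = embed (foldr (\<lambda>s. geom_reflection m (simple_root s)) u v) \<and>
    foldr (\<lambda>s. geom_reflection m (simple_root s)) u v \<in> geom_space S"
  using assms(1)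
proof (induction u)
  case Nil
  then show ?case using assms(2) by simp
next
  case (Cons s u)
  then show ?case
    by (simp add: reflect_embed geom_reflection_in_geom_space simple_root_in_geom_space)
qed

lemma rep_embed:
  assumes "w \<in> carrier G" "v \<in> geom_space S"
  shows "rep w (embed v) = embed (geom_action G S m w v)" "geom_action G S m w v \<in> geom_space S"
  using act_embed[OF conjunct1[OF word_of[OF assms(1)]] assms(2)]
  by (simp_all add: rep_def geom_action_def word_of_def)

lemma reflections_iff: "t \<in> T \<longleftrightarrow> (\<exists>w\<in>carrier G. \<exists>s\<in>S. t = w \<otimes> s \<otimes> inv w)"
  by (auto simp: reflections_def l_coset_def r_coset_def)

lemma reflections_carrier: "T \<subseteq> carrier G"
  using S_carrier by (auto simp: reflections_iff subset_iff)

lemma T_lists_carrier: "ts \<in> lists T \<Longrightarrow> ts \<in> lists (carrier G)"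
  using reflections_carrier by auto

lemma generators_are_reflections: "S \<subseteq> T"
proof
  fix s assume "s \<in> S"
  then have "s = \<one> \<otimes> s \<otimes> inv \<one>" using S_carrier by auto
  then show "s \<in> T" using \<open>s \<in> S\<close> unfolding reflections_iff by blast
qed

lemma reflections_conjugate:
  assumes "g \<in> carrier G" "t \<in> T"
  shows "g \<otimes> t \<otimes> inv g \<in> T"
proof -
  obtain w s where w: "w \<in> carrier G" "s \<in> S" "t = w \<otimes> s \<otimes> inv w"
    using assms(2) reflections_iff by blast
  then have "g \<otimes> t \<otimes> inv g = (g \<otimes> w) \<otimes> s \<otimes> inv (g \<otimes> w)"
    using assms(1) S_carrier by (simp add: m_assoc inv_mult_group subset_iff)
  then show ?thesis
    using w assms(1) unfolding reflections_iff by blast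
qed

lemma rep_reflection:
  assumes "w \<in> carrier G" "s \<in> S"
  shows "rep (w \<otimes> s \<otimes> inv w) = reflect (rep w (embed (simple_root s)))"
proof -
  let ?u = "word_of w"
  have u: "?u \<in> lists S" "word_prod G ?u = w" using word_of[OF assms(1)] by auto
  have "w \<otimes> s \<otimes> inv w = word_prod G (?u @ [s] @ rev ?u)"
    using u assms S_carrier S_lists_carrier
    by (simp add: word_prod_append word_prod_rev m_assoc subset_iff in_lists_conv_set)
  moreover have "?u @ [s] @ rev ?u \<in> lists S" using u(1) assms(2) by auto
  ultimately have "rep (w \<otimes> s \<otimes> inv w) = act (?u @ [s] @ rev ?u)"
    using rep_word_prod by metis
  also have "\<dots> = reflect (act ?u (embed (simple_root s)))"
  proof
    fix v
    have "act (?u @ [s] @ rev ?u) v = act ?u (reflect (embed (simple_root s)) (act (rev ?u) v))"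
      by (simp add: act_append)
    then show "act (?u @ [s] @ rev ?u) v = reflect (act ?u (embed (simple_root s))) v"
      using reflect_conjugate[of "map (\<lambda>s. embed (simple_root s)) ?u" "embed (simple_root s)" v] u(1)
      by (auto simp: act_def rev_map form_simple_self)
  qed
  finally show ?thesis by (simp add: rep_def)
qed

lemma root_system_geom:
  assumes "\<beta> \<in> root_system G S m"
  shows "\<beta> \<in> geom_space S" "geom_form m \<beta> \<beta> = 1"
proof -
  obtain w s where w: "w \<in> carrier G" "s \<in> S" and \<beta>: "\<beta> = geom_action G S m w (simple_root s)"
    using assms by (auto simp: root_system_def)
  have s: "simple_root s \<in> geom_space S" by (rule simple_root_in_geom_space[OF w(2)])
  show geom: "\<beta> \<in> geom_space S" using rep_embed(2)[OF w(1) s] \<beta> by simp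
  have "extended_form S m (embed \<beta>) (embed \<beta>) = extended_form S m (embed (simple_root s)) (embed (simple_root s))"
    unfolding \<beta> rep_embed(1)[OF w(1) s, symmetric] rep_def act_def
    using word_of[OF w(1)] by (intro reflect_word_isometry) (auto simp: form_simple_self)
  then show "geom_form m \<beta> \<beta> = 1"
    using extended_form_geom[OF finite_S geom geom, of m] form_simple_self[OF w(2)] by simp
qed

lemma cone_nonneg: "embed v \<in> cone \<Longrightarrow> 0 \<le> Poly_Mapping.lookup v r"
proof -
  assume "embed v \<in> cone"
  then obtain a where a: "\<forall>s. 0 \<le> a s" "embed v = (\<Sum>s\<in>S. a s *\<^sub>R embed (simple_root s))"
    by (auto simp: cone_def)
  have "(\<Sum>s\<in>S. a s *\<^sub>R embed (simple_root s)) = embed (\<Sum>s\<in>S. a s *\<^sub>R simple_root s)"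
    by (simp add: linear_sum[OF linear_pair_zero])
  then have "v = (\<Sum>s\<in>S. a s *\<^sub>R simple_root s)" using a(2) by simp
  then show ?thesis using a(1) by (simp add: lookup_simple_root_sum[OF finite_S])
qed

text \<open>
  The reflection \<open>w s w\<inverse>\<close> is the reflection in \<open>\<gamma>\<close>, the image of the simple root of
  \<open>s\<close> under \<open>w\<close>. By the sign dichotomy \<open>\<gamma>\<close> or \<open>-\<gamma>\<close> is positive; the latter
  is again a root, namely the image of the simple root under \<open>w s\<close>, and defines the same reflection.
\<close>

lemma positive_root_exists:
  assumes "t \<in> T"
  shows "\<exists>\<beta>\<in>positive_roots G S m. rep t = reflect (embed \<beta>)"
proof -
  obtain w s where w: "w \<in> carrier G" "s \<in> S" and t: "t = w \<otimes> s \<otimes> inv w"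
    using assms reflections_iff by blast
  have s: "simple_root s \<in> geom_space S" by (rule simple_root_in_geom_space[OF w(2)])
  define \<gamma> where "\<gamma> = geom_action G S m w (simple_root s)"
  have rep_t: "rep t = reflect (embed \<gamma>)" and rep_w: "rep w (embed (simple_root s)) = embed \<gamma>"
    using rep_reflection[OF w] rep_embed(1)[OF w(1) s] by (simp_all add: t \<gamma>_def)
  have \<gamma>: "\<gamma> \<in> root_system G S m" using w by (auto simp: root_system_def \<gamma>_def)
  have ws: "w \<otimes> s \<in> carrier G" using w S_carrier by auto
  have "rep s v = reflect (embed (simple_root s)) v" for v
    using rep_word_prod[of "[s]"] w(2) S_carrier by (auto simp: subset_iff)
  then have "rep (w \<otimes> s) (embed (simple_root s)) = rep w (- embed (simple_root s))"
    using rep_mult[OF w(1), of s] w(2) S_carrier form_simple_self[OF w(2)]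
    by (auto simp: reflect_self)
  also have "\<dots> = - embed \<gamma>"
    using rep_w linear_neg[OF linear_act, of "word_of w" "embed (simple_root s)"]
    by (simp add: rep_def)
  finally have "geom_action G S m (w \<otimes> s) (simple_root s) = - \<gamma>"
    using rep_embed(1)[OF ws s] by simp
  then have neg: "- \<gamma> \<in> root_system G S m"
    using ws w(2) unfolding root_system_def by force
  have "embed \<gamma> \<in> cone \<or> - embed \<gamma> \<in> cone"
    using act_simple_sign[of "word_of w" s] word_of[OF w(1)] w(2) rep_w by (auto simp: rep_def)
  then show ?thesis
  proof
    assume "embed \<gamma> \<in> cone"
    then show ?thesis
      using \<gamma> rep_t cone_nonneg by (intro bexI[of _ \<gamma>]) (auto simp: positive_roots_def)
  next
    assume "- embed \<gamma> \<in> cone"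
    then have "embed (- \<gamma>) \<in> cone" by simp
    moreover have "rep t = reflect (embed (- \<gamma>))"
      using rep_t reflect_uminus[of "embed \<gamma>"] by simp
    ultimately show ?thesis
      using neg cone_nonneg unfolding positive_roots_def by blast
  qed
qed

text \<open>
  A reflection negates its root, which determines the root up to a scalar; the norm leaves only the sign
  open, and positivity settles it.
\<close>

lemma positive_root_unique:
  assumes "\<beta> \<in> positive_roots G S m" "\<gamma> \<in> positive_roots G S m"
    and eq: "\<And>v. v \<in> geom_space S \<Longrightarrow> geom_reflection m \<beta> v = geom_reflection m \<gamma> v"
  shows "\<beta> = \<gamma>"
proof -
  have \<beta>: "\<beta> \<in> geom_space S" "geom_form m \<beta> \<beta> = 1" and \<gamma>: "\<gamma> \<in> geom_space S" "geom_form m \<gamma> \<gamma> = 1"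
    using assms(1,2) root_system_geom by (auto simp: positive_roots_def)
  let ?k = "geom_form m \<gamma> \<beta>"
  have "2 *\<^sub>R \<beta> = 2 *\<^sub>R (?k *\<^sub>R \<gamma>)"
    using eq[OF \<beta>(1)] \<beta>(2) by (simp add: geom_reflection_def)
  then have k: "\<beta> = ?k *\<^sub>R \<gamma>"
    by (metis scaleR_left_imp_eq zero_neq_numeral)
  have "extended_form S m (embed \<beta>) (embed \<beta>) = ?k * ?k * extended_form S m (embed \<gamma>) (embed \<gamma>)"
    using form_scale[of ?k "embed \<gamma>"] form_scale_right[of _ ?k "embed \<gamma>"] k
    by (metis mult.assoc scaleR_Pair scaleR_zero_right)
  then have "?k * ?k = 1"
    using \<beta> \<gamma> by (simp add: extended_form_geom[OF finite_S])
  then consider "?k = 1" | "?k = - 1"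
    using square_eq_1_iff by blast
  then show ?thesis
  proof cases
    case 1
    then show ?thesis using k by simp
  next
    case 2
    have "Poly_Mapping.lookup \<beta> s = 0" for s
    proof -
      have "Poly_Mapping.lookup \<beta> s = - Poly_Mapping.lookup \<gamma> s"
        using arg_cong[OF k, of "\<lambda>v. Poly_Mapping.lookup v s"] 2 by simp
      moreover have "0 \<le> Poly_Mapping.lookup \<beta> s" "0 \<le> Poly_Mapping.lookup \<gamma> s"
        using assms(1,2) by (auto simp: positive_roots_def)
      ultimately show ?thesis by simp
    qed
    then have "\<beta> = 0" by (simp add: poly_mapping_eqI)
    then show ?thesis using \<beta>(2) by (simp add: geom_form_def)
  qed
qed

text \<open>
  This discharges the definite description in \<open>root_of\<close>; afterwards only these three properties of
  the root are used.
\<close>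

lemma root_of_reflection:
  assumes "t \<in> T"
  shows "root t \<in> geom_space S" "geom_form m (root t) (root t) = 1" "rep t = reflect (embed (root t))"
proof -
  obtain \<beta> where \<beta>: "\<beta> \<in> positive_roots G S m" "rep t = reflect (embed \<beta>)"
    using positive_root_exists[OF assms] by blast
  have t: "t \<in> carrier G" using assms reflections_carrier by auto
  have geom: "\<beta> \<in> geom_space S" "geom_form m \<beta> \<beta> = 1"
    using \<beta>(1) root_system_geom by (auto simp: positive_roots_def)
  have action: "geom_action G S m t v = geom_reflection m \<beta> v" if "v \<in> geom_space S" for v
    using rep_embed(1)[OF t that] reflect_embed[OF geom(1) that] \<beta>(2) by simp
  have "root t = \<beta>"
    unfolding root_of_def
  proof (rule the_equality)
    show "\<beta> \<in> positive_roots G S m \<and> (\<forall>v\<in>geom_space S. geom_action G S m t v = geom_reflection m \<beta> v)"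
      using \<beta>(1) action by blast
    fix \<gamma>
    assume "\<gamma> \<in> positive_roots G S m \<and> (\<forall>v\<in>geom_space S. geom_action G S m t v = geom_reflection m \<gamma> v)"
    then show "\<gamma> = \<beta>"
      using action by (intro positive_root_unique[OF _ \<beta>(1)]) simp_all
  qed
  then show "root t \<in> geom_space S" "geom_form m (root t) (root t) = 1" "rep t = reflect (embed (root t))"
    using geom \<beta>(2) by simp_all
qed

lemma rep_reflection_word:
  assumes "ts \<in> lists T"
  shows "rep (word_prod G ts) = reflect_word (map (\<lambda>t. embed (root t)) ts)"
proof
  fix v
  show "rep (word_prod G ts) v = reflect_word (map (\<lambda>t. embed (root t)) ts) v"
    using assms
  proof (induction ts)
    case (Cons t ts)
    then have "t \<in> carrier G" "word_prod G ts \<in> carrier G"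
      using reflections_carrier T_lists_carrier by auto
    then show ?case
      using Cons by (simp add: rep_mult root_of_reflection(3))
  qed simp
qed

section \<open>Reflection length and the absolute order\<close>

lemma T_reduced_expression_exists:
  assumes "x \<in> carrier G"
  shows "\<exists>ts. T_reduced_expression G S x ts"
proof -
  obtain u where "u \<in> lists S" "word_prod G u = x" using word_exists[OF assms] by blast
  then have "\<exists>k. \<exists>ts\<in>lists T. length ts = k \<and> word_prod G ts = x"
    using generators_are_reflections by (intro exI[of _ "length u"] bexI[of _ u]) auto
  then have "\<exists>ts\<in>lists T. length ts = \<l> x \<and> word_prod G ts = x"
    unfolding refl_length_def by (rule LeastI_ex)
  then show ?thesis by (auto simp: T_reduced_expression_def)
qed

lemma refl_length_le:
  assumes "ts \<in> lists T"
  shows "\<l> (word_prod G ts) \<le> length ts"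
  unfolding refl_length_def using assms by (intro Least_le) blast

lemma refl_length_reflection:
  assumes "t \<in> T"
  shows "\<l> t = 1"
proof -
  have t: "t \<in> carrier G" using assms reflections_carrier by auto
  have "\<l> t \<le> 1" using refl_length_le[of "[t]"] assms t by simp
  moreover have "\<l> t \<noteq> 0"
  proof
    assume "\<l> t = 0"
    then have "t = \<one>"
      using T_reduced_expression_exists[OF t] by (auto simp: T_reduced_expression_def)
    then have "reflect (embed (root t)) (embed (root t)) = embed (root t)"
      using root_of_reflection(3)[OF assms] by (metis rep_one)
    moreover have "extended_form S m (embed (root t)) (embed (root t)) = 1"
      using root_of_reflection(1,2)[OF assms] by (simp add: extended_form_geom[OF finite_S])
    ultimately have "- embed (root t) = embed (root t)"
      using reflect_self by metis
    then have "root t = 0" by (simp add: neg_eq_iff_add_eq_0 flip: scaleR_2)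
    then show False
      using root_of_reflection(2)[OF assms] by (simp add: geom_form_def)
  qed
  ultimately show ?thesis by linarith
qed

lemma refl_length_mult_reflection:
  assumes "t \<in> T" "x \<in> carrier G"
  shows "\<l> (t \<otimes> x) \<le> Suc (\<l> x)"
proof -
  obtain ts where "T_reduced_expression G S x ts" using T_reduced_expression_exists[OF assms(2)] by blast
  then show ?thesis
    using refl_length_le[of "t # ts"] assms by (auto simp: T_reduced_expression_def)
qed

lemma absolute_le_first_letter:
  assumes "t \<in> T" "x \<in> carrier G" "absolute_le G S t x"
  shows "\<exists>ts. T_reduced_expression G S x (t # ts)"
proof -
  have t: "t \<in> carrier G" using assms reflections_carrier by auto
  obtain ts where ts: "T_reduced_expression G S (inv t \<otimes> x) ts"
    using T_reduced_expression_exists t assms(2) by blast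
  have "t \<otimes> (inv t \<otimes> x) = x" using t assms(2) by (simp add: m_assoc[symmetric])
  then show ?thesis
    using ts assms(1,3) refl_length_reflection[OF assms(1)]
    by (intro exI[of _ ts]) (auto simp: T_reduced_expression_def absolute_le_def)
qed

text \<open>
  Every letter of a reduced expression, not only the first, lies below its value: conjugating the letters
  before \<open>t\<close> by \<open>t\<close> moves \<open>t\<close> to the front.
\<close>

lemma absolute_le_letter:
  assumes ts: "T_reduced_expression G S x ts" and "t \<in> set ts"
  shows "absolute_le G S t x"
proof -
  obtain as ds where split: "ts = as @ t # ds" using assms(2) by (metis split_list)
  have T: "as \<in> lists T" "t \<in> T" "ds \<in> lists T" and x: "x = word_prod G ts"
    and len: "length ts = \<l> x"
    using ts split by (auto simp: T_reduced_expression_def)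
  have C: "as \<in> lists (carrier G)" "t \<in> carrier G" "ds \<in> lists (carrier G)"
    using T T_lists_carrier reflections_carrier by auto
  let ?as = "map (\<lambda>r. inv t \<otimes> r \<otimes> inv (inv t)) as"
  have asT: "?as \<in> lists T"
    using T(1) C(2) reflections_conjugate[of "inv t"] by auto
  have "word_prod G (?as @ ds) = (inv t \<otimes> word_prod G as \<otimes> t) \<otimes> word_prod G ds"
    using C asT T_lists_carrier[OF asT] word_prod_conjugate[of "inv t" as] by (subst word_prod_append) auto
  also have "\<dots> = inv t \<otimes> x"
    using C by (simp add: x split word_prod_append m_assoc)
  finally have prod: "word_prod G (?as @ ds) = inv t \<otimes> x" .
  have "\<l> (inv t \<otimes> x) \<le> length (?as @ ds)"
    using refl_length_le[of "?as @ ds"] asT T(3) unfolding prod by auto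
  then have "Suc (\<l> (inv t \<otimes> x)) \<le> \<l> x"
    using len split by simp
  moreover have "x \<in> carrier G" using C by (simp add: x split)
  then have "\<l> x \<le> Suc (\<l> (inv t \<otimes> x))"
    using refl_length_mult_reflection[OF T(2), of "inv t \<otimes> x"] C(2) by (simp add: m_assoc[symmetric])
  ultimately show ?thesis
    using refl_length_reflection[OF T(2)] by (simp add: absolute_le_def)
qed

section \<open>Reflection factorizations of Coxeter elements\<close>

text \<open>
  The Coxeter element is a product of the reflections in the simple roots, which are independent, so in the
  enlarged space its moved space is all of \<open>V\<close>. Any reflection factorization has roots spanning a space
  that contains the moved space, and with at most \<open>card S\<close> roots it can do so only if they are independent.
\<close>

lemma coxeter_element_factorization_independent:
  assumes c: "coxeter_element G S c" and ts: "ts \<in> lists T" "word_prod G ts = c"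
    and len: "length ts \<le> card S"
  shows "distinct (map root ts) \<and> independent (set (map root ts))"
proof -
  obtain ws where ws: "distinct ws" "set ws = S" "c = word_prod G ws"
    using c by (auto simp: coxeter_element_def)
  let ?\<alpha> = "\<lambda>s. embed (simple_root s)"
  have inj: "inj_on ?\<alpha> S"
  proof (rule inj_onI)
    fix s t assume "?\<alpha> s = ?\<alpha> t"
    then have "Poly_Mapping.lookup (simple_root s) s = Poly_Mapping.lookup (simple_root t) s" by simp
    then show "s = t" by (simp add: lookup_simple_root split: if_splits)
  qed
  have image: "?\<alpha> ` S = embed ` simple_root ` S" by (simp add: image_image)
  have ind: "independent (?\<alpha> ` S)"
    unfolding image independent_pair_zero by (rule independent_simple_roots[OF finite_S])
  have "rep c = reflect_word (map ?\<alpha> ws)"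
    using rep_word_prod[of ws] ws by (simp add: act_def in_lists_conv_set)
  moreover have "moved_space (reflect_word (map ?\<alpha> ws)) = span (set (map ?\<alpha> ws))"
    using ws inj ind
    by (intro moved_space_independent[OF separates_geom_space])
      (auto simp: distinct_map intro: simple_root_in_geom_space)
  ultimately have "moved_space (rep c) = span (?\<alpha> ` S)" by (simp add: ws)
  moreover have "moved_space (rep c) \<subseteq> span (set (map (\<lambda>t. embed (root t)) ts))"
    using moved_space_subset_span[of "map (\<lambda>t. embed (root t)) ts"] rep_reflection_word[OF ts(1)] ts(2)
    by simp
  ultimately have "?\<alpha> ` S \<subseteq> span (set (map (\<lambda>t. embed (root t)) ts))"
    using span_superset by blast
  then have *: "distinct (map (\<lambda>t. embed (root t)) ts) \<and> independent (set (map (\<lambda>t. embed (root t)) ts))"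
    using len card_image[OF inj] by (intro spanning_list_independent[OF ind]) auto
  have eq: "map (\<lambda>t. embed (root t)) ts = map embed (map root ts)" by simp
  from * have "distinct (map embed (map root ts))" "independent (embed ` set (map root ts))"
    unfolding eq set_map[of embed] by blast+
  then show ?thesis
    unfolding independent_pair_zero using distinct_map[of embed "map root ts"] by blast
qed

text \<open>
  A reduced expression of \<open>x\<close> followed by one of \<open>x\<inverse> c\<close> is a factorization of \<open>c\<close> with
  \<open>card S\<close> letters at most, and independence passes from its roots to those of \<open>x\<close>.
\<close>

lemma below_coxeter_element_independent:
  assumes c: "coxeter_element G S c" and x: "x \<in> absolute_interval G S c"
    and ts: "T_reduced_expression G S x ts"
  shows "distinct (map root ts) \<and> independent (set (map root ts))"
proof -
  have xC: "x \<in> carrier G" and le: "\<l> x + \<l> (inv x \<otimes> c) = \<l> c"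
    using x by (auto simp: absolute_interval_def absolute_le_def)
  obtain ws where ws: "distinct ws" "set ws = S" "c = word_prod G ws"
    using c by (auto simp: coxeter_element_def)
  have wsT: "ws \<in> lists T" using ws generators_are_reflections by auto
  have "\<l> c \<le> card S"
    using refl_length_le[OF wsT] ws distinct_card[OF ws(1)] by simp
  have cC: "c \<in> carrier G" using ws(3) T_lists_carrier[OF wsT] by simp
  obtain us where us: "T_reduced_expression G S (inv x \<otimes> c) us"
    using T_reduced_expression_exists xC cC by blast
  have lists: "ts \<in> lists T" "us \<in> lists T"
    using ts us by (auto simp: T_reduced_expression_def)
  have "word_prod G (ts @ us) = x \<otimes> (inv x \<otimes> c)"
    using word_prod_append[OF T_lists_carrier[OF lists(1)] T_lists_carrier[OF lists(2)]] ts us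
    by (simp add: T_reduced_expression_def)
  also have "\<dots> = c" using xC cC by (simp add: m_assoc[symmetric])
  finally have "word_prod G (ts @ us) = c" .
  moreover have "length (ts @ us) \<le> card S"
    using ts us le \<open>\<l> c \<le> card S\<close> by (simp add: T_reduced_expression_def)
  ultimately have "distinct (map root (ts @ us)) \<and> independent (set (map root (ts @ us)))"
    using coxeter_element_factorization_independent[OF c, of "ts @ us"] lists by simp
  then show ?thesis
    using independent_mono[of "set (map root (ts @ us))" "set (map root ts)"] by auto
qed

lemma moved_space_rep_independent:
  assumes ts: "ts \<in> lists T" and ind: "distinct (map root ts)" "independent (set (map root ts))"
  shows "embed v \<in> moved_space (rep (word_prod G ts)) \<longleftrightarrow> v \<in> span (set (map root ts))"
proof -
  have eq: "map (\<lambda>t. embed (root t)) ts = map embed (map root ts)" by simp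
  have "moved_space (reflect_word (map embed (map root ts))) = span (set (map embed (map root ts)))"
  proof (rule moved_space_independent[OF separates_geom_space])
    show "set (map embed (map root ts)) \<subseteq> embed ` geom_space S"
      using ts root_of_reflection(1) by auto
    show "distinct (map embed (map root ts))"
      using ind(1) by (subst distinct_map) (simp add: inj_on_def)
    show "independent (set (map embed (map root ts)))"
      using ind(2) by (simp only: set_map[of embed] independent_pair_zero not_False_eq_True)
  qed
  then show ?thesis
    unfolding rep_reflection_word[OF ts] eq set_map[of embed] by (simp add: span_pair_zero del: set_map)
qed

text \<open>
  For each reduced expression of \<open>x\<close> the span of its roots is the moved space of \<open>x\<close>, which
  does not mention the expression. Hence the span is the same for an expression that begins with any
  prescribed reflection below \<open>x\<close>.
\<close>

lemma abs_moved_space_eq_span: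
  assumes c: "coxeter_element G S c" and x: "x \<in> absolute_interval G S c"
    and ts: "T_reduced_expression G S x ts"
  shows "abs_moved_space G S m x = span (set (map root ts))"
proof -
  let ?R = "{root t |t. t \<in> T \<and> absolute_le G S t x}"
  have moved: "embed v \<in> moved_space (rep x) \<longleftrightarrow> v \<in> span (set (map root us))"
    if us: "T_reduced_expression G S x us" for us v
    using moved_space_rep_independent[of us v] below_coxeter_element_independent[OF c x us] us
    by (auto simp: T_reduced_expression_def)
  have "?R \<subseteq> span (set (map root ts))"
  proof clarify
    fix t assume t: "t \<in> T" "absolute_le G S t x"
    obtain us where us: "T_reduced_expression G S x (t # us)"
      using absolute_le_first_letter[OF t(1) _ t(2)] x by (auto simp: absolute_interval_def)
    have "root t \<in> span (set (map root (t # us)))" by (intro span_base) simp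
    then show "root t \<in> span (set (map root ts))"
      using moved[OF us] moved[OF ts] by blast
  qed
  moreover have "set (map root ts) \<subseteq> ?R"
  proof
    fix \<beta> assume "\<beta> \<in> set (map root ts)"
    then obtain t where t: "\<beta> = root t" "t \<in> set ts" by auto
    then have "t \<in> T" using ts by (auto simp: T_reduced_expression_def)
    then show "\<beta> \<in> ?R" using absolute_le_letter[OF ts t(2)] t(1) by blast
  qed
  then have "set (map root ts) \<subseteq> span ?R"
    using span_superset[of ?R] by (rule subset_trans)
  ultimately show ?thesis
    unfolding abs_moved_space_def span_eq by (rule conjI)
qed

end

theorem proposition3p7:
  fixes G :: "('a, 'b) monoid_scheme"
    and S :: "'a set"
    and m :: "'a \<Rightarrow> 'a \<Rightarrow> enat"
    and c x :: 'a
  assumes "coxeter_system G S m"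
    and "finite S"
    and "coxeter_element G S c"
    and "x \<in> absolute_interval G S c"
  shows "dim (abs_moved_space G S m x) = refl_length G S x \<and>
    (\<forall>ts. T_reduced_expression G S x ts \<longrightarrow>
       internal_direct_sum (abs_moved_space G S m x) (map (\<lambda>t. span {root_of G S m t}) ts))"
proof -
  interpret finite_rank_coxeter_system G S m
    by unfold_locales (fact assms)+
  note independent = below_coxeter_element_independent[OF assms(3,4)]
    and span = abs_moved_space_eq_span[OF assms(3,4)]
  obtain ts where ts: "T_reduced_expression G S x ts"
    using T_reduced_expression_exists assms(4) by (auto simp: absolute_interval_def)
  have "dim (abs_moved_space G S m x) = card (set (map root ts))"
    unfolding span[OF ts] using independent[OF ts] by (intro dim_span_eq_card_independent) simp
  also have "\<dots> = refl_length G S x"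
    using independent[OF ts] ts distinct_card[of "map root ts"] by (simp add: T_reduced_expression_def)
  finally have "dim (abs_moved_space G S m x) = refl_length G S x" .
  moreover have "internal_direct_sum (abs_moved_space G S m x) (map (\<lambda>t. span {root t}) us)"
    if us: "T_reduced_expression G S x us" for us
    using internal_direct_sum_independent[of "map root us"] independent[OF us]
    unfolding span[OF us] by (simp add: o_def)
  ultimately show ?thesis by blast
qed

end
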